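(* Let $X$ and $Y$ be subsets of complete separable metric spaces, equipped with $\sigma$-finite Borel measures $\mu$ on $X$ and $\nu$ on $Y$. Suppose there is a numbered limb system $S = \bigcup_{i=1}^\infty \mathrm{Graph}(f_{2i-1}) \cup \mathrm{Antigraph}(f_{2i}) \subset X\times Y$ with the property that $\mathrm{Graph}(f_{2i-1})$ and $\mathrm{Antigraph}(f_{2i})$ are $\gamma$-measurable subsets of $X \times Y$ for each $i \ge 1$ and for every $\gamma \in \Gamma(\mu,\nu)$ vanishing outside of $S$. If the system has finitely many limbs or $\mu[X]<\infty$, then at most one $\gamma \in \Gamma(\mu,\nu)$ vanishes outside of $S$. If such a measure exists, it is given by $\gamma = \sum_{k=1}^\infty \gamma_k$ where, for each $i \ge 1$, $$\gamma_{2i-1} = (\mathrm{id}_{X} \times f_{2i-1})_\# \eta_{2i-1}, \qquad \gamma_{2i} = (f_{2i} \times \mathrm{id}_{Y})_\# \eta_{2i},$$ $$\eta_{2i-1} = \big(\mu - \pi^{X}_\#\gamma_{2i}\big)\big|_{\mathrm{Dom} f_{2i-1}}, \qquad \eta_{2i} = \big(\nu - \pi^{Y}_\#\gamma_{2i+1}\big)\big|_{\mathrm{Dom} f_{2i}}.$$ Here each $f_k$ ($k\ge 1$) is measurable with respect to the $\eta_{k}$-completion of the Borel $\sigma$-algebra. If the system has $N<\infty$ limbs, then $\gamma_k=0$ for $k > N$, and $\eta_k$ and $\gamma_k$ can be computed recursively from the formulae above starting from $k=N$.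
   Context: Measures and projections. $\pi^X(x,y)=x$ and $\pi^Y(x,y)=y$ are the projections of $X\times Y$. For a Borel measure $m$ and an $m$-measurable map $f$ (that is, $f^{-1}(B)$ lies in the $m$-completion of the Borel $\sigma$-algebra for each Borel $B$ in the target), the push-forward is $(f_\# m)[B] := m[f^{-1}(B)]$ for Borel $B$. The map $\mathrm{id}_X\times f$ sends $x\mapsto (x,f(x))$ and $f\times \mathrm{id}_Y$ sends $y\mapsto (f(y),y)$. $\Gamma(\mu,\nu)$ denotes the set of non-negative Borel measures $\gamma$ on $X\times Y$ with marginals $\pi^X_\#\gamma=\mu$ and $\pi^Y_\#\gamma=\nu$. A measure $\gamma$ vanishes outside of $S\subset X\times Y$ if $\gamma$ assigns zero outer measure to $(X\times Y)\setminus S$. A set is $\gamma$-measurable if it belongs to the $\gamma$-completion of the Borel $\sigma$-algebra. Graphs. For a map $f$ defined on a set $D=\mathrm{Dom} f$, $\mathrm{Graph}(f)=\{(x,f(x)) : x\in D\}$, $\mathrm{Antigraph}(f)=\{(f(x),x) : x\in D\}$, and $\mathrm{Ran} f=f(D)$. Numbered limb system. A relation $S\subset X\times Y$ is a numbered limb system if there are countable disjoint decompositions $X=\bigcup_{i=0}^\infty I_{2i+1}$ and $Y=\bigcup_{i=0}^\infty I_{2i}$ (some $I_k$ may be empty), and a sequence of maps $f_{2i}:\mathrm{Dom}(f_{2i})\subset Y\to X$ and $f_{2i+1}:\mathrm{Dom}(f_{2i+1})\subset X\to Y$ ($i\ge 0$), such that $S=\bigcup_{i=1}^\infty \mathrm{Graph}(f_{2i-1})\cup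 \mathrm{Antigraph}(f_{2i})$, with $\mathrm{Dom}(f_k)\cup \mathrm{Ran}(f_{k+1})\subset I_k$ for each $k\ge 0$. (The map $f_0$ is irrelevant and may be taken to have empty domain.) The system has (at most) $N$ limbs if $\mathrm{Dom}(f_k)=\emptyset$ for all $k>N$.
   Formalization: Added: the extensions of μ and ν to the ambient complete separable metric spaces assign zero outer measure to the complements of X and Y (automatic for Borel X, Y). For arbitrary non-measurable subsets the formulae for γ can fail. *)

theory Defs
  imports "HOL-Analysis.Analysis"
begin

text \<open>
  A Borel measure on a subset \<open>X\<close> of a Polish space is a measure whose \<open>\<sigma>\<close>-algebra is that of
  \<open>restrict_space borel X\<close>, i.e. the Borel \<open>\<sigma>\<close>-algebra of the subspace topology.  Maps defined only
  on part of a space are of type \<open>'a \<rightharpoonup> 'b\<close>, with \<open>dom\<close>, \<open>ran\<close> and \<open>Map.graph\<close> as their domain,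
  range and graph.
\<close>

definition antigraph :: "('b \<rightharpoonup> 'a) \<Rightarrow> ('a \<times> 'b) set" where
  "antigraph g = {(x, y). g y = Some x}"

text \<open>
  The limb \<open>f\<^sub>k\<close> goes from \<open>X\<close> to \<open>Y\<close> for odd \<open>k\<close> and from \<open>Y\<close> to \<open>X\<close> for even \<open>k\<close>.  As these have
  different types, the sequence is split into \<open>f\<close> and \<open>g\<close>, both indexed by the original \<open>k\<close>: only the
  odd entries of \<open>f\<close> and the even entries of \<open>g\<close> are used.  The same holds for the
  pieces \<open>I k\<close> (odd, in \<open>X\<close>) and \<open>J k\<close> (even, in \<open>Y\<close>).
\<close>

definition numbered_limb_system ::
  "'a set \<Rightarrow> 'b set \<Rightarrow> ('a \<times> 'b) set \<Rightarrow> (nat \<Rightarrow> 'a \<rightharpoonup> 'b) \<Rightarrow> (nat \<Rightarrow> 'b \<rightharpoonup> 'a) \<Rightarrow> bool" where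
  "numbered_limb_system X Y S f g \<longleftrightarrow>
     (\<exists>I J.
        X = (\<Union>i. I (2*i+1)) \<and> disjoint_family (\<lambda>i. I (2*i+1)) \<and>
        Y = (\<Union>i. J (2*i)) \<and> disjoint_family (\<lambda>i. J (2*i)) \<and>
        (\<forall>i. dom (g (2*i)) \<union> ran (f (2*i+1)) \<subseteq> J (2*i)) \<and>
        (\<forall>i. dom (f (2*i+1)) \<union> ran (g (2*i+2)) \<subseteq> I (2*i+1))) \<and>
     ran (g 0) \<subseteq> X \<and>
     S = (\<Union>i\<in>{1..}. Map.graph (f (2*i-1)) \<union> antigraph (g (2*i)))"

definition at_most_limbs :: "(nat \<Rightarrow> 'a \<rightharpoonup> 'b) \<Rightarrow> (nat \<Rightarrow> 'b \<rightharpoonup> 'a) \<Rightarrow> nat \<Rightarrow> bool" where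
  "at_most_limbs f g N \<longleftrightarrow>
     (\<forall>k>N. (odd k \<longrightarrow> dom (f k) = {}) \<and> (even k \<longrightarrow> dom (g k) = {}))"

definition borel_on_product ::
  "'a::polish_space measure \<Rightarrow> 'b::polish_space measure \<Rightarrow> ('a \<times> 'b) measure" where
  "borel_on_product \<mu> \<nu> = restrict_space borel (space \<mu> \<times> space \<nu>)"

definition couplings ::
  "'a::polish_space measure \<Rightarrow> 'b::polish_space measure \<Rightarrow> ('a \<times> 'b) measure set" where
  "couplings \<mu> \<nu> =
     {\<gamma>. sets \<gamma> = sets (borel_on_product \<mu> \<nu>) \<and> distr \<gamma> \<mu> fst = \<mu> \<and> distr \<gamma> \<nu> snd = \<nu>}"

definition vanishes_outside :: "'a measure \<Rightarrow> 'a set \<Rightarrow> bool" where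
  "vanishes_outside M S \<longleftrightarrow> outer_measure_of M (space M - S) = 0"

text \<open>
  A Borel measure \<open>\<mu>\<close> on an arbitrary subset \<open>X\<close> extends to the ambient Polish space as
  \<open>distr \<mu> borel (\<lambda>x. x)\<close>.  This extension vanishes outside \<open>X\<close> whenever \<open>X\<close> is Borel, as the next
  lemma shows, but not for every \<open>X\<close>: it fails for the trace of Lebesgue measure on a subset of
  \<open>[0, 1]\<close> with outer measure 1 and inner measure 0.  Marginals of measures carried by graphs need
  not live on the domains of these graphs in the latter situation, so the theorem asks that the
  extensions of \<open>\<mu>\<close> and \<open>\<nu>\<close> vanish outside \<open>X\<close> and \<open>Y\<close>.  Counterexample otherwise: let \<open>D\<close>
  and \<open>E\<close> be complementary subsets of \<open>[0, 1]\<close>, both of outer Lebesgue measure 1, let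
  \<open>X = [0, 1]\<close> with Lebesgue measure, \<open>Y = D \<times> {0} \<union> E \<times> {1}\<close>, \<open>f\<^sub>1 x = (x, 0)\<close> on \<open>D\<close> and
  \<open>f\<^sub>3 x = (x, 1)\<close> on \<open>E\<close>.  Giving the two (closed) graphs the trace measures with weights
  \<open>c\<close> and \<open>1 - c\<close> defines couplings with the same first marginal for all \<open>c\<close>, although
  \<open>\<eta>\<^sub>1 = \<mu>|D\<close> and \<open>\<eta>\<^sub>3 = \<mu>|E\<close> do not depend on \<open>c\<close>.
\<close>

lemma vanishes_outside_borel:
  fixes \<mu> :: "'a::polish_space measure"
  assumes X: "X \<in> sets borel" and \<mu>: "sets \<mu> = sets (restrict_space borel X)"
  shows "vanishes_outside (distr \<mu> borel (\<lambda>x. x)) X"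
proof -
  have space: "space \<mu> = X"
    using sets_eq_imp_space_eq[OF \<mu>] by (simp add: space_restrict_space)
  have meas: "(\<lambda>x. x) \<in> measurable \<mu> borel"
    unfolding measurable_cong_sets[OF \<mu> refl] by (rule measurable_restrict_space1) simp
  have "UNIV - X \<in> sets borel"
    using X by auto
  then show ?thesis
    using meas by (simp add: vanishes_outside_def emeasure_distr space Int_commute)
qed

text \<open>
  Difference of measures.  Unlike \<^const>\<open>diff_measure\<close>, this is also correct if \<open>\<rho>\<close> is infinite, as
  long as it is \<open>\<sigma>\<close>-finite: there is then at most one \<open>\<delta>\<close> with \<open>\<delta> + \<rho> = \<mu>\<close>.
\<close>

definition measure_minus :: "'a measure \<Rightarrow> 'a measure \<Rightarrow> 'a measure" where
  "measure_minus \<mu> \<rho> =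
     (THE \<delta>. sets \<delta> = sets \<mu> \<and> (\<forall>A\<in>sets \<mu>. emeasure \<delta> A + emeasure \<rho> A = emeasure \<mu> A))"

lemma measure_minus_eqI:
  assumes "sigma_finite_measure \<rho>" and \<rho>: "sets \<rho> = sets \<mu>" and \<delta>: "sets \<delta> = sets \<mu>"
    and sum: "\<And>A. A \<in> sets \<mu> \<Longrightarrow> emeasure \<delta> A + emeasure \<rho> A = emeasure \<mu> A"
  shows "measure_minus \<mu> \<rho> = \<delta>"
  unfolding measure_minus_def
proof (rule the_equality)
  show "sets \<delta> = sets \<mu> \<and> (\<forall>A\<in>sets \<mu>. emeasure \<delta> A + emeasure \<rho> A = emeasure \<mu> A)"
    using \<delta> sum by blast
next
  fix \<delta>'
  assume \<delta>': "sets \<delta>' = sets \<mu> \<and> (\<forall>A\<in>sets \<mu>. emeasure \<delta>' A + emeasure \<rho> A = emeasure \<mu> A)"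
  obtain E :: "nat \<Rightarrow> 'a set" where E: "range E \<subseteq> sets \<rho>" "(\<Union>i. E i) = space \<rho>"
      "\<And>i. emeasure \<rho> (E i) \<noteq> \<infinity>" "disjoint_family E"
    using sigma_finite_measure.sigma_finite_disjoint[OF assms(1)] by blast
  show "\<delta>' = \<delta>"
  proof (rule measure_eqI)
    show "sets \<delta>' = sets \<delta>"
      using \<delta> \<delta>' by simp
    fix A assume "A \<in> sets \<delta>'"
    then have A: "A \<in> sets \<mu>"
      using \<delta>' by simp
    have AE: "A \<inter> E i \<in> sets \<mu>" for i
      using A E(1) \<rho> by auto
    have eq: "emeasure \<delta>' (A \<inter> E i) = emeasure \<delta> (A \<inter> E i)" for i
    proof -
      have "emeasure \<rho> (A \<inter> E i) \<le> emeasure \<rho> (E i)"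
        using E(1) by (intro emeasure_mono) auto
      then have "emeasure \<rho> (A \<inter> E i) \<noteq> \<infinity>"
        using E(3)[of i] by (auto simp: top_unique)
      moreover have "emeasure \<delta>' (A \<inter> E i) + emeasure \<rho> (A \<inter> E i)
          = emeasure \<delta> (A \<inter> E i) + emeasure \<rho> (A \<inter> E i)"
        using \<delta>' sum AE by simp
      ultimately show ?thesis
        by (metis add.commute ennreal_add_left_cancel infinity_ennreal_def)
    qed
    have "A \<subseteq> space \<rho>"
      using A \<rho> sets.sets_into_space by blast
    then have U: "A = (\<Union>i. A \<inter> E i)"
      using E(2) by blast
    have disj: "disjoint_family (\<lambda>i. A \<inter> E i)"
      using E(4) unfolding disjoint_family_on_def by blast
    have "emeasure \<delta>' A = (\<Sum>i. emeasure \<delta>' (A \<inter> E i))"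
      by (subst U, rule suminf_emeasure[symmetric]) (use AE \<delta>' disj in auto)
    also have "\<dots> = (\<Sum>i. emeasure \<delta> (A \<inter> E i))"
      using eq by simp
    also have "\<dots> = emeasure \<delta> A"
      by (subst (2) U, rule suminf_emeasure) (use AE \<delta> disj in auto)
    finally show "emeasure \<delta>' A = emeasure \<delta> A" .
  qed
qed

text \<open>
  The restriction \<open>M|D\<close>, again as a measure on the \<open>\<sigma>\<close>-algebra of \<open>M\<close>.  The set \<open>D\<close> need not be
  Borel; for \<open>D\<close> in the completion of \<open>M\<close>, the outer measure of \<open>B \<inter> D\<close> is its completed measure.
\<close>

definition restrict_measure :: "'a measure \<Rightarrow> 'a set \<Rightarrow> 'a measure" where
  "restrict_measure M D = measure_of (space M) (sets M) (\<lambda>B. outer_measure_of M (B \<inter> D))"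

definition completion_measurable :: "'a measure \<Rightarrow> 'b measure \<Rightarrow> ('a \<rightharpoonup> 'b) \<Rightarrow> bool" where
  "completion_measurable M N F \<longleftrightarrow> (\<forall>B\<in>sets N. F -` (Some ` B) \<in> sets (completion M))"

definition pushforward :: "'a measure \<Rightarrow> 'b measure \<Rightarrow> ('a \<rightharpoonup> 'b) \<Rightarrow> 'b measure" where
  "pushforward M N F = distr (restrict_space (completion M) (dom F)) N (\<lambda>x. the (F x))"

definition id_times :: "('a \<rightharpoonup> 'b) \<Rightarrow> 'a \<rightharpoonup> 'a \<times> 'b" where
  "id_times f = (\<lambda>x. map_option (\<lambda>y. (x, y)) (f x))"

definition times_id :: "('b \<rightharpoonup> 'a) \<Rightarrow> 'b \<rightharpoonup> 'a \<times> 'b" where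
  "times_id g = (\<lambda>y. map_option (\<lambda>x. (x, y)) (g y))"

text \<open>
  \<open>\<eta>\<^sub>k\<close> for odd and for even \<open>k\<close>, as a function of \<open>\<gamma>' = \<gamma>\<^bsub>k+1\<^esub>\<close>, and the recursion for \<open>\<gamma>\<^sub>k\<close>
  that goes down from \<open>\<gamma>\<^bsub>N+1\<^esub> = 0\<close>.
\<close>

definition limb_eta_odd :: "'a measure \<Rightarrow> (nat \<Rightarrow> 'a \<rightharpoonup> 'b) \<Rightarrow> nat \<Rightarrow> ('a \<times> 'b) measure \<Rightarrow> 'a measure"
  where "limb_eta_odd \<mu> f k \<gamma>' = restrict_measure (measure_minus \<mu> (distr \<gamma>' \<mu> fst)) (dom (f k))"

definition limb_eta_even :: "'b measure \<Rightarrow> (nat \<Rightarrow> 'b \<rightharpoonup> 'a) \<Rightarrow> nat \<Rightarrow> ('a \<times> 'b) measure \<Rightarrow> 'b measure"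
  where "limb_eta_even \<nu> g k \<gamma>' = restrict_measure (measure_minus \<nu> (distr \<gamma>' \<nu> snd)) (dom (g k))"

function limb_gamma ::
  "'a::polish_space measure \<Rightarrow> 'b::polish_space measure \<Rightarrow> (nat \<Rightarrow> 'a \<rightharpoonup> 'b) \<Rightarrow> (nat \<Rightarrow> 'b \<rightharpoonup> 'a) \<Rightarrow>
   nat \<Rightarrow> nat \<Rightarrow> ('a \<times> 'b) measure" where
  "limb_gamma \<mu> \<nu> f g N k =
     (if k > N then null_measure (borel_on_product \<mu> \<nu>)
      else if odd k then
        pushforward (limb_eta_odd \<mu> f k (limb_gamma \<mu> \<nu> f g N (Suc k)))
          (borel_on_product \<mu> \<nu>) (id_times (f k))
      else
        pushforward (limb_eta_even \<nu> g k (limb_gamma \<mu> \<nu> f g N (Suc k)))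
          (borel_on_product \<mu> \<nu>) (times_id (g k)))"
  by pat_completeness auto
termination
  by (relation "Wellfounded.measure (\<lambda>(\<mu>, \<nu>, f, g, N, k). Suc N - k)") auto

declare limb_gamma.simps [simp del]

end

theory Submission
  imports Defs
begin

text \<open>
  Let \<open>\<gamma>\<close> be a coupling carried by the limbs.  By inner regularity each limb contains a
  \<open>\<sigma>\<close>-compact set with the same \<open>\<gamma>\<close>-measure, and \<open>\<gamma>\<^sub>k\<close> is the restriction of \<open>\<gamma>\<close> to that set.
  Projections of \<open>\<sigma>\<close>-compact sets are Borel, so no analytic sets appear.  Over the domain of limb
  \<open>k\<close> only the limbs \<open>k\<close> and \<open>k + 1\<close> contribute to the marginal, so the marginal minus the projection
  of \<open>\<gamma>\<^bsub>k+1\<^esub>\<close>, restricted to this domain, is the projection of \<open>\<gamma>\<^sub>k\<close>, which determines \<open>\<gamma>\<^sub>k\<close>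
  because limb \<open>k\<close> is a graph over it.

  With finitely many limbs this recursion determines \<open>\<gamma>\<close>.  If \<open>\<mu>\<close> is finite and \<open>\<gamma>'\<close> is a second
  coupling, it gives for each \<open>A\<close> a set \<open>A'\<close> with \<open>\<bar>(\<gamma>\<^sub>k - \<gamma>'\<^sub>k)(A)\<bar> = \<bar>(\<gamma>\<^bsub>k+1\<^esub> - \<gamma>'\<^bsub>k+1\<^esub>)(A')\<bar>\<close>;
  iterating, this is bounded by the masses of limbs of arbitrarily high number, which tend to \<open>0\<close>.
\<close>

section \<open>Sigma-compact cores and their Borel images\<close>

lemma countable_UN_compact_borel:
  fixes C :: "nat \<Rightarrow> 'c::t2_space set"
  assumes "\<And>n. compact (C n)"
  shows "(\<Union>n. C n) \<in> sets borel"
  using assms by (intro sets.countable_UN) (auto intro: borel_compact)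

text \<open>By inner regularity the measure of \<open>B\<close> is a supremum over compact subsets,
  and such a supremum is approached along a sequence. Its union has the measure of \<open>B\<close>,
  and finiteness turns this into a null difference.\<close>

lemma finite_measure_compact_core:
  fixes M :: "'c::{second_countable_topology, complete_space} measure"
  assumes "finite_measure M" and M: "sets M = sets borel" and B: "B \<in> sets borel"
  obtains C :: "nat \<Rightarrow> 'c set"
  where "\<And>n. compact (C n)" "\<And>n. C n \<subseteq> B" "B - (\<Union>n. C n) \<in> null_sets M"
proof -
  interpret finite_measure M by fact
  let ?Q = "{K. K \<subseteq> B \<and> compact K}"
  have "?Q \<noteq> {}" by (auto intro: exI[of _ "{}"])
  from ennreal_SUP_countable_SUP[OF this, of "emeasure M"]
  obtain h where h: "range h \<subseteq> emeasure M ` ?Q" "(SUP K\<in>?Q. emeasure M K) = (SUP i::nat. h i)"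
    by auto
  then have "\<forall>i. \<exists>K. K \<subseteq> B \<and> compact K \<and> h i = emeasure M K" by (auto simp: image_subset_iff)
  then obtain C where C: "\<And>i. C i \<subseteq> B" "\<And>i. compact (C i)" "\<And>i. h i = emeasure M (C i)"
    by metis
  have CM: "C i \<in> sets M" for i
    using C(2) M by (simp add: borel_compact)
  then have U: "(\<Union>i. C i) \<in> sets M" by blast
  have "emeasure M B = (SUP i. emeasure M (C i))"
    using inner_regular[OF M _ B] h(2) C(3) by simp
  also have "\<dots> \<le> emeasure M (\<Union>i. C i)"
    using U CM by (intro SUP_least emeasure_mono) auto
  finally have "emeasure M (B - (\<Union>i. C i)) = 0"
    using C(1) B M U by (subst emeasure_Diff) (auto intro!: diff_eq_0_ennreal simp: top.not_eq_extremum[symmetric])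
  then show thesis
    using C(1,2) B M U by (intro that[of C]) auto
qed

text \<open>Inner regularity is applied to finite Borel measures on the whole space, so
  \<open>\<gamma>\<close> is replaced by a finite measure with the same null sets, pushed forward
  along the inclusion. Since \<open>Z\<close> may fail to be Borel, the Borel set \<open>Z0\<close>
  of full measure stands in for it.\<close>

lemma compact_core:
  fixes \<gamma> :: "'c::{second_countable_topology, complete_space} measure"
  assumes "sigma_finite_measure \<gamma>" and \<gamma>: "sets \<gamma> = sets (restrict_space borel Z)"
    and A: "A \<in> sets (completion \<gamma>)"
    and Z0: "Z0 \<in> sets borel" "Z0 \<subseteq> Z" "Z - Z0 \<in> null_sets \<gamma>"
  obtains C :: "nat \<Rightarrow> 'c set"
  where "\<And>n. compact (C n)" "\<And>n. C n \<subseteq> A" "A - (\<Union>n. C n) \<in> null_sets (completion \<gamma>)"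
proof -
  interpret sigma_finite_measure \<gamma> by fact
  have sp: "space \<gamma> = Z"
    using sets_eq_imp_space_eq[OF \<gamma>] by (simp add: space_restrict_space)
  \<comment> \<open>Sigma-finiteness supplies \<open>h\<close>; integrability makes the density
    finite, and positivity preserves the null sets.\<close>
  obtain h where h: "h \<in> borel_measurable \<gamma>" "integral\<^sup>N \<gamma> h \<noteq> \<infinity>"
      "\<And>x. x \<in> space \<gamma> \<Longrightarrow> 0 < h x"
    using Ex_finite_integrable_function by blast
  let ?H = "density \<gamma> h"
  have nullH: "N \<in> null_sets ?H \<longleftrightarrow> N \<in> null_sets \<gamma>" for N
  proof -
    have "(AE x in \<gamma>. x \<in> N \<longrightarrow> h x = 0) \<longleftrightarrow> (AE x in \<gamma>. x \<notin> N)"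
      using h(3) by (intro AE_cong) (metis less_irrefl)
    then show ?thesis
      using h(1) AE_iff_null_sets[of N \<gamma>] by (auto simp: null_sets_density_iff null_setsD2)
  qed
  have id: "(\<lambda>z. z) \<in> ?H \<rightarrow>\<^sub>M borel"
    unfolding measurable_cong_sets[OF sets_density refl] measurable_cong_sets[OF \<gamma> refl]
    by (rule measurable_restrict_space1) simp
  let ?G = "distr ?H borel (\<lambda>z. z)"
  have "finite_measure ?H"
    by (intro finite_measureI) (use h in \<open>simp add: emeasure_density cong: nn_integral_cong\<close>)
  then have finG: "finite_measure ?G"
    using finite_measure.finite_measure_distr[OF _ id] by blast
  obtain M N N' where A': "A = M \<union> N" "N \<subseteq> N'" "N' \<in> null_sets \<gamma>" "M \<in> sets \<gamma>"
    using A by (rule sets_completionE)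
  obtain M' where M': "M' \<in> sets borel" "M = Z \<inter> M'"
    using A'(4) unfolding \<gamma> sets_restrict_space by auto
  \<comment> \<open>\<open>M\<close> is only the trace of \<open>M'\<close> on \<open>Z\<close>;
    cutting with \<open>Z0\<close> gives a Borel set of the whole space and loses only part of
    \<open>Z - Z0\<close>.\<close>
  have B: "M' \<inter> Z0 \<in> sets borel" using M' Z0 by auto
  have "\<exists>C :: nat \<Rightarrow> 'c set. (\<forall>n. compact (C n)) \<and> (\<forall>n. C n \<subseteq> M' \<inter> Z0) \<and>
      M' \<inter> Z0 - (\<Union>n. C n) \<in> null_sets ?G"
    by (rule finite_measure_compact_core[OF finG sets_distr B]) blast
  then obtain C :: "nat \<Rightarrow> 'c set" where C: "\<And>n. compact (C n)" "\<And>n. C n \<subseteq> M' \<inter> Z0"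
      "M' \<inter> Z0 - (\<Union>n. C n) \<in> null_sets ?G"
    by blast
  have "M' \<inter> Z0 - (\<Union>n. C n) \<in> null_sets ?H"
    using C(3) id Z0(2) null_sets_distr_iff[OF id] sp by (simp add: Int_absorb2 subset_iff)
  then have "(M' \<inter> Z0 - (\<Union>n. C n)) \<union> (Z - Z0) \<union> N' \<in> null_sets \<gamma>"
    unfolding nullH using Z0(3) A'(3) by blast
  moreover have "A - (\<Union>n. C n) \<subseteq> (M' \<inter> Z0 - (\<Union>n. C n)) \<union> (Z - Z0) \<union> N'"
    using A' M' by blast
  ultimately have "A - (\<Union>n. C n) \<in> null_sets (completion \<gamma>)"
    unfolding null_sets_completion_iff2 by blast
  moreover have "C n \<subseteq> A" for n
    using C(2)[of n] A' M' Z0(2) by blast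
  ultimately show thesis using C(1) that by blast
qed

text \<open>For closed sets the image is sigma-compact. Injectivity turns the image of a complement
  into a difference of images, so induction over the generation of Borel sets from closed sets
  applies; without it the argument breaks at complements.\<close>

lemma image_sigma_compact_borel:
  fixes p :: "'c::t2_space \<Rightarrow> 'd::t2_space"
  assumes p: "continuous_on UNIV p" and C: "\<And>n::nat. compact (C n)"
    and inj: "inj_on p (\<Union>n. C n)" and A: "A \<in> sets borel"
  shows "p ` (A \<inter> (\<Union>n. C n)) \<in> sets borel"
proof -
  let ?K = "\<Union>n. C n"
  have closed: "p ` (F \<inter> ?K) \<in> sets borel" if "closed F" for F
  proof -
    have "p ` (F \<inter> ?K) = (\<Union>n. p ` (F \<inter> C n))" by blast
    moreover have "compact (p ` (F \<inter> C n))" for n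
      using that C by (intro compact_continuous_image continuous_on_subset[OF p]) auto
    ultimately show ?thesis
      using borel_compact by (metis (no_types, lifting) sets.countable_UN image_subsetI)
  qed
  have "A \<in> sigma_sets UNIV (Collect closed)"
    using A by (simp add: borel_eq_closed)
  then show ?thesis
  proof induction
    case (Basic F)
    then show ?case using closed by simp
  next
    case (Compl F)
    have "p ` ((UNIV - F) \<inter> ?K) = p ` (UNIV \<inter> ?K) - p ` (F \<inter> ?K)"
      using inj unfolding inj_on_def by blast
    then show ?case using closed[of UNIV] Compl by auto
  next
    case (Union F)
    have "p ` (\<Union>(range F) \<inter> ?K) = (\<Union>i. p ` (F i \<inter> ?K))" by blast
    then show ?case using Union by auto
  qed simp
qed

section \<open>Null complements and null measures\<close>

lemma vanishes_outside_null_sets: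
  assumes "vanishes_outside M S"
  shows "space M - S \<in> null_sets (completion M)"
proof -
  obtain E where "E \<in> sets M" "space M - S \<subseteq> E" "emeasure M E = 0"
    using assms outer_measure_of_attain[of "space M - S" M]
    unfolding vanishes_outside_def by auto
  then show ?thesis
    unfolding null_sets_completion_iff2 by blast
qed

text \<open>Vanishing outside \<open>X\<close> provides a Borel null set \<open>N\<close> containing
  the complement of \<open>X\<close>; the complement of \<open>N\<close> is the core.\<close>

lemma vanishes_outside_borel_core:
  fixes \<mu> :: "'a::topological_space measure"
  assumes \<mu>: "sets \<mu> = sets (restrict_space borel X)"
    and "vanishes_outside (distr \<mu> borel (\<lambda>x. x)) X"
  obtains X0 where "X0 \<in> sets borel" "X0 \<subseteq> X" "X - X0 \<in> null_sets \<mu>"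
proof -
  have sp: "space \<mu> = X"
    using sets_eq_imp_space_eq[OF \<mu>] by (simp add: space_restrict_space)
  have id: "(\<lambda>x. x) \<in> \<mu> \<rightarrow>\<^sub>M borel"
    unfolding measurable_cong_sets[OF \<mu> refl] by (rule measurable_restrict_space1) simp
  obtain N where N: "N \<in> null_sets (distr \<mu> borel (\<lambda>x. x))" "UNIV - X \<subseteq> N"
    using vanishes_outside_null_sets[OF assms(2)] unfolding null_sets_completion_iff2 by auto
  have "X - (UNIV - N) = N \<inter> X" by blast
  then have "X - (UNIV - N) \<in> null_sets \<mu>"
    using N(1) null_sets_distr_iff[OF id] sp by simp
  moreover have "UNIV - N \<in> sets borel" using N(1) by (auto simp: null_sets_def)
  ultimately show thesis using N(2) by (intro that[of "UNIV - N"]) auto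
qed

lemma null_measure_eqI:
  assumes "sets M = sets N" "emeasure M (space M) = 0"
  shows "M = null_measure N"
proof (rule measure_eqI)
  show "sets M = sets (null_measure N)" using assms by simp
  fix A assume "A \<in> sets M"
  then have "emeasure M A \<le> emeasure M (space M)"
    by (intro emeasure_mono) (auto dest: sets.sets_into_space)
  then show "emeasure M A = emeasure (null_measure N) A" using assms by simp
qed

section \<open>Two consecutive limbs over a common marginal\<close>

text \<open>
  One step of the recursion: \<open>p\<close> is a projection of the product, \<open>s\<close> the section of \<open>p\<close> given by the
  limb number \<open>a\<close>, and \<open>b\<close> is the only other limb that meets the fibres over the domain of \<open>s\<close>.
\<close>

locale limb_pair = sigma_finite_measure \<mu>
  for \<mu> :: "'x measure" +
  fixes \<gamma> :: "'z measure" and p :: "'z \<Rightarrow> 'x" and K :: "nat \<Rightarrow> 'z set"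
    and s :: "'x \<rightharpoonup> 'z" and a b :: nat
  assumes p [measurable]: "p \<in> \<gamma> \<rightarrow>\<^sub>M \<mu>" and marginal: "distr \<gamma> \<mu> p = \<mu>"
    and K [measurable]: "\<And>j. K j \<in> sets \<gamma>" and pK: "\<And>j. p ` K j \<in> sets \<mu>"
    and carried: "space \<gamma> - (\<Union>j. K j) \<in> null_sets \<gamma>"
    and disj: "K a \<inter> K b = {}"
    and section_K: "\<And>z. z \<in> K a \<Longrightarrow> s (p z) = Some z"
    and s_section: "\<And>x z. s x = Some z \<Longrightarrow> z \<in> space \<gamma> \<and> p z = x"
    and image: "\<And>A. A \<in> sets \<gamma> \<Longrightarrow> p ` (A \<inter> K a) \<in> sets \<mu>"
    and other: "\<And>j. j \<noteq> a \<Longrightarrow> j \<noteq> b \<Longrightarrow> dom s \<inter> p ` K j = {}"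
begin

abbreviation piece :: "nat \<Rightarrow> 'z measure" where
  "piece j \<equiv> density \<gamma> (indicator (K j))"

abbreviation eta :: "'x measure" where
  "eta \<equiv> distr (piece a) \<mu> p"

lemma emeasure_piece: "A \<in> sets \<gamma> \<Longrightarrow> emeasure (piece j) A = emeasure \<gamma> (K j \<inter> A)"
  by (rule emeasure_restricted) simp_all

lemma emeasure_distr_piece:
  assumes [measurable]: "B \<in> sets \<mu>"
  shows "emeasure (distr (piece j) \<mu> p) B = emeasure \<gamma> (K j \<inter> p -` B)"
proof -
  have "K j \<inter> (p -` B \<inter> space \<gamma>) = K j \<inter> p -` B"
    using sets.sets_into_space[OF K] by blast
  moreover have "p \<in> piece j \<rightarrow>\<^sub>M \<mu>"
    by simp
  moreover have "p -` B \<inter> space \<gamma> \<in> sets \<gamma>" by measurable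
  ultimately show ?thesis by (simp add: emeasure_distr emeasure_piece)
qed

lemma emeasure_eta: "B \<in> sets \<mu> \<Longrightarrow> emeasure eta B = emeasure \<gamma> (K a \<inter> p -` B)"
  by (rule emeasure_distr_piece)

lemma dom_s: "dom s \<subseteq> space \<mu>"
  using s_section measurable_space[OF p] by (metis domD subsetI)

lemma inj: "z \<in> K a \<Longrightarrow> z' \<in> K a \<Longrightarrow> p z = p z' \<Longrightarrow> z = z'"
  using section_K by (metis option.inject)

lemma vimage_image: "K a \<inter> p -` p ` (A \<inter> K a) = K a \<inter> A"
  using inj by blast

text \<open>The marginal turns \<open>\<mu>\<close> into the mass of \<open>\<gamma>\<close> over
  \<open>B\<close>; up to a null set this mass lies in the cores, and only those of \<open>a\<close>
  and \<open>b\<close> meet the fibres over \<open>B\<close>.\<close>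

lemma emeasure_fibre:
  assumes [measurable]: "B \<in> sets \<mu>" and B: "\<And>j. j \<noteq> a \<Longrightarrow> j \<noteq> b \<Longrightarrow> B \<inter> p ` K j = {}"
  shows "emeasure \<mu> B = emeasure \<gamma> (K a \<inter> p -` B) + emeasure \<gamma> (K b \<inter> p -` B)"
proof -
  have v: "K j \<inter> p -` B = K j \<inter> (p -` B \<inter> space \<gamma>)" for j
    using sets.sets_into_space[OF K] by blast
  have [measurable]: "K j \<inter> p -` B \<in> sets \<gamma>" for j
    unfolding v by measurable
  have "emeasure \<mu> B = emeasure \<gamma> (p -` B \<inter> space \<gamma>)"
    by (subst marginal[symmetric]) (simp add: emeasure_distr)
  also have "\<dots> = emeasure \<gamma> ((K a \<inter> p -` B) \<union> (K b \<inter> p -` B))"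
  proof (rule emeasure_eq_AE)
    show "AE z in \<gamma>. z \<in> p -` B \<inter> space \<gamma> \<longleftrightarrow> z \<in> (K a \<inter> p -` B) \<union> (K b \<inter> p -` B)"
      using AE_not_in[OF carried]
    proof eventually_elim
      case (elim z)
      have "j = a \<or> j = b" if "z \<in> K j" "p z \<in> B" for j
        using B[of j] that by blast
      then show ?case
        using elim sets.sets_into_space[OF K[of a]] sets.sets_into_space[OF K[of b]] by auto
    qed
  qed measurable
  also have "\<dots> = emeasure \<gamma> (K a \<inter> p -` B) + emeasure \<gamma> (K b \<inter> p -` B)"
    using disj by (intro plus_emeasure[symmetric]) auto
  finally show ?thesis .
qed

text \<open>The candidate for \<open>\<mu>\<close> minus the marginal of \<open>piece b\<close>,
  obtained without subtracting infinite values. It projects all of \<open>\<gamma>\<close> off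
  \<open>K b\<close>, not just \<open>piece a\<close>, because away from \<open>dom s\<close> other
  limbs contribute.\<close>

definition rest :: "'x measure" where
  "rest = distr (density \<gamma> (indicator (space \<gamma> - K b))) \<mu> p"

lemma sets_rest [simp]: "sets rest = sets \<mu>" and space_rest [simp]: "space rest = space \<mu>"
  by (simp_all add: rest_def)

lemma emeasure_rest:
  assumes [measurable]: "B \<in> sets \<mu>"
  shows "emeasure rest B = emeasure \<gamma> (p -` B \<inter> space \<gamma> - K b)"
proof -
  have "p -` B \<inter> space \<gamma> \<in> sets \<gamma>" by measurable
  then have "emeasure rest B = emeasure \<gamma> ((space \<gamma> - K b) \<inter> (p -` B \<inter> space \<gamma>))"
    unfolding rest_def by (simp add: emeasure_distr emeasure_restricted)
  also have "(space \<gamma> - K b) \<inter> (p -` B \<inter> space \<gamma>) = p -` B \<inter> space \<gamma> - K b" by blast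
  finally show ?thesis .
qed

lemma rest_plus:
  assumes [measurable]: "B \<in> sets \<mu>"
  shows "emeasure rest B + emeasure (distr (piece b) \<mu> p) B = emeasure \<mu> B"
proof -
  have v: "K b \<inter> p -` B = K b \<inter> (p -` B \<inter> space \<gamma>)"
    using sets.sets_into_space[OF K] by blast
  have "emeasure rest B + emeasure (distr (piece b) \<mu> p) B
      = emeasure \<gamma> ((p -` B \<inter> space \<gamma> - K b) \<union> (K b \<inter> (p -` B \<inter> space \<gamma>)))"
    unfolding emeasure_rest[OF assms] emeasure_distr_piece[OF assms] v
    by (intro plus_emeasure) auto
  also have "(p -` B \<inter> space \<gamma> - K b) \<union> (K b \<inter> (p -` B \<inter> space \<gamma>)) = p -` B \<inter> space \<gamma>" by blast
  also have "emeasure \<gamma> \<dots> = emeasure \<mu> B"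
    using emeasure_distr[OF p assms] unfolding marginal by simp
  finally show ?thesis .
qed

text \<open>The marginal of \<open>piece b\<close> is dominated by \<open>\<mu>\<close>, hence
  sigma-finite, which is what makes the difference unique.\<close>

lemma measure_minus_marginal: "measure_minus \<mu> (distr (piece b) \<mu> p) = rest"
proof (rule measure_minus_eqI)
  obtain E :: "nat \<Rightarrow> 'x set" where E: "range E \<subseteq> sets \<mu>" "(\<Union>i. E i) = space \<mu>"
      "\<And>i. emeasure \<mu> (E i) \<noteq> \<infinity>"
    using sigma_finite by blast
  have "emeasure (distr (piece b) \<mu> p) (E i) \<le> emeasure \<mu> (E i)" for i
    using E(1) rest_plus[of "E i"] by (metis add_increasing zero_le le_iff_add add.commute range_subsetD)
  then have "emeasure (distr (piece b) \<mu> p) (E i) \<noteq> \<infinity>" for i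
    using E(3)[of i] by (metis infinity_ennreal_def top.extremum_unique)
  then show "sigma_finite_measure (distr (piece b) \<mu> p)"
    using E by (intro sigma_finite_measure.intro exI[of _ "range E"]) auto
qed (use rest_plus in auto)

text \<open>Every measurable cover of \<open>B \<inter> dom s\<close> contains the projection of the
  part of \<open>K a\<close> over \<open>B\<close>, which bounds the outer measure from below; a
  cover that avoids the projections of the remaining cores gives the upper bound.\<close>

lemma outer_rest:
  assumes B: "B \<in> sets \<mu>"
  shows "outer_measure_of rest (B \<inter> dom s) = emeasure eta B"
proof (rule antisym)
  have [measurable]: "B \<in> sets \<mu>" by fact
  \<comment> \<open>By \<open>other\<close> the removed projections miss \<open>dom s\<close>, so
    \<open>D\<close> still covers \<open>B \<inter> dom s\<close>; off \<open>K b\<close>, almost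
    all mass over \<open>D\<close> lies in \<open>K a\<close>.\<close>
  define D where "D = B - (\<Union>j\<in>- {a, b}. p ` K j)"
  have D[measurable]: "D \<in> sets \<mu>"
    unfolding D_def using B pK by (intro sets.Diff sets.countable_UN'') auto
  have "outer_measure_of rest (B \<inter> dom s) \<le> emeasure rest D"
    unfolding outer_measure_of_def
    by (intro INF_lower) (use D other in \<open>auto simp: D_def\<close>)
  also have "\<dots> \<le> emeasure \<gamma> (K a \<inter> p -` B)"
  proof -
    have v: "K a \<inter> p -` B = K a \<inter> (p -` B \<inter> space \<gamma>)"
      using sets.sets_into_space[OF K] by blast
    show ?thesis
      unfolding emeasure_rest[OF D] v
    proof (rule emeasure_mono_AE)
      show "AE z in \<gamma>. z \<in> p -` D \<inter> space \<gamma> - K b \<longrightarrow> z \<in> K a \<inter> (p -` B \<inter> space \<gamma>)"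
        using AE_not_in[OF carried]
      proof eventually_elim
        case (elim z)
        show ?case
        proof (intro impI)
          assume z: "z \<in> p -` D \<inter> space \<gamma> - K b"
          then obtain j where j: "z \<in> K j" using elim by auto
          then have "j = a \<or> j = b" using z unfolding D_def by auto
          then have "z \<in> K a" using z j by auto
          then show "z \<in> K a \<inter> (p -` B \<inter> space \<gamma>)" using z unfolding D_def by simp
        qed
      qed
    qed measurable
  qed
  finally show "outer_measure_of rest (B \<inter> dom s) \<le> emeasure eta B"
    using emeasure_eta[OF B] by simp
  show "emeasure eta B \<le> outer_measure_of rest (B \<inter> dom s)"
    unfolding outer_measure_of_def
  proof (rule INF_greatest)
    fix D assume "D \<in> {C \<in> sets rest. B \<inter> dom s \<subseteq> C}"
    then have D[measurable]: "D \<in> sets \<mu>" and sub: "B \<inter> dom s \<subseteq> D" by auto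
    have "K a \<inter> p -` B \<subseteq> p -` D \<inter> space \<gamma> - K b"
    proof
      fix z assume z: "z \<in> K a \<inter> p -` B"
      then have "p z \<in> D" using sub section_K by blast
      then show "z \<in> p -` D \<inter> space \<gamma> - K b"
        using z disj sets.sets_into_space[OF K[of a]] by blast
    qed
    then have "emeasure eta B \<le> emeasure \<gamma> (p -` D \<inter> space \<gamma> - K b)"
      unfolding emeasure_eta[OF B] by (intro emeasure_mono) measurable
    then show "emeasure eta B \<le> emeasure rest D"
      using emeasure_rest[OF D] by simp
  qed
qed

lemma restrict_minus_marginal:
  "restrict_measure (measure_minus \<mu> (distr (piece b) \<mu> p)) (dom s) = eta"
proof -
  have "restrict_measure rest (dom s) = measure_of (space \<mu>) (sets \<mu>) (emeasure eta)"
    unfolding restrict_measure_def sets_rest space_rest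
    by (rule measure_of_eq) (simp_all add: sets.space_closed outer_rest sets.sigma_sets_eq)
  also have "\<dots> = eta"
    using measure_of_of_measure[of eta] by simp
  finally show ?thesis unfolding measure_minus_marginal .
qed

text \<open>On the projection of the core, \<open>s\<close> inverts \<open>p\<close>. The rest of
  \<open>dom s\<close> may be non-measurable, but it is confined to a set that is null for
  \<open>eta\<close>, so the completion absorbs it.\<close>

lemma preimage_eq:
  assumes A: "A \<in> sets \<gamma>"
  obtains N where "s -` (Some ` A) = p ` (A \<inter> K a) \<union> N" "N \<subseteq> space \<mu> - p ` K a"
proof -
  have "z \<in> K a" if "s x = Some z" "x \<in> p ` K a" for x z
    using that section_K by auto
  then have "s -` (Some ` A) \<inter> p ` K a \<subseteq> p ` (A \<inter> K a)"
    using s_section by (smt (verit, ccfv_threshold) IntE IntI imageE image_eqI subsetI vimageE)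
  moreover have "p ` (A \<inter> K a) \<subseteq> s -` (Some ` A)"
    using section_K by auto
  ultimately have "s -` (Some ` A) = p ` (A \<inter> K a) \<union> (s -` (Some ` A) - p ` K a)"
    by blast
  moreover have "s -` (Some ` A) - p ` K a \<subseteq> space \<mu> - p ` K a"
    using dom_s by auto
  ultimately show thesis by (rule that)
qed

lemma null_eta: "space \<mu> - p ` K a \<in> null_sets eta"
proof (rule null_setsI)
  have D: "space \<mu> - p ` K a \<in> sets \<mu>" using pK by blast
  then show "space \<mu> - p ` K a \<in> sets eta" by simp
  have "K a \<inter> p -` (space \<mu> - p ` K a) = {}" by blast
  then show "emeasure eta (space \<mu> - p ` K a) = 0"
    using emeasure_eta[OF D] by simp
qed

lemma preimage_sets:
  assumes A: "A \<in> sets \<gamma>"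
  shows "s -` (Some ` A) \<in> sets (completion eta)"
proof -
  obtain N where "s -` (Some ` A) = p ` (A \<inter> K a) \<union> N" "N \<subseteq> space \<mu> - p ` K a"
    using A by (rule preimage_eq)
  then show ?thesis
    using null_eta image[OF A] by (intro sets_completionI) auto
qed

lemma emeasure_preimage:
  assumes A: "A \<in> sets \<gamma>"
  shows "emeasure (completion eta) (s -` (Some ` A)) = emeasure (piece a) A"
proof -
  obtain N where N: "s -` (Some ` A) = p ` (A \<inter> K a) \<union> N" "N \<subseteq> space \<mu> - p ` K a"
    using A by (rule preimage_eq)
  have "N \<in> null_sets (completion eta)"
    using N(2) null_eta unfolding null_sets_completion_iff2 by blast
  then have "emeasure (completion eta) (s -` (Some ` A)) = emeasure (completion eta) (p ` (A \<inter> K a))"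
    unfolding N(1) using image[OF A] by (intro emeasure_Un_null_set) auto
  also have "\<dots> = emeasure (piece a) A"
    using image[OF A] by (simp add: emeasure_eta vimage_image emeasure_piece A)
  finally show ?thesis .
qed

lemma pushforward_eta:
  assumes N: "sets N = sets \<gamma>"
  shows "pushforward eta N s = piece a"
proof (rule measure_eqI)
  have spN: "space N = space \<gamma>" using N by (rule sets_eq_imp_space_eq)
  show "sets (pushforward eta N s) = sets (piece a)"
    by (simp add: pushforward_def N)
  fix A assume "A \<in> sets (pushforward eta N s)"
  then have A: "A \<in> sets \<gamma>" by (simp add: pushforward_def N)
  \<comment> \<open>As the preimage of the whole space, the domain is measurable for the completion,
    so the completed measure can be restricted to it.\<close>
  have dom: "dom s = s -` (Some ` space \<gamma>)"
    using s_section by (auto simp: dom_def)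
  then have dom_sets: "dom s \<in> sets (completion eta)"
    using preimage_sets by simp
  have v: "(\<lambda>x. the (s x)) -` B \<inter> dom s = s -` (Some ` B)" for B
    by (auto simp: dom_def image_iff) 
  have space: "space (restrict_space (completion eta) (dom s)) = dom s"
    using dom_s by (auto simp: space_restrict_space)
  have "(\<lambda>x. the (s x)) \<in> restrict_space (completion eta) (dom s) \<rightarrow>\<^sub>M N"
  proof (rule measurableI)
    fix x assume "x \<in> space (restrict_space (completion eta) (dom s))"
    then show "the (s x) \<in> space N"
      using s_section unfolding space spN by auto
  next
    fix B assume "B \<in> sets N"
    then show "(\<lambda>x. the (s x)) -` B \<inter> space (restrict_space (completion eta) (dom s))
        \<in> sets (restrict_space (completion eta) (dom s))"
      unfolding space v using N preimage_sets dom_sets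
      by (subst sets_restrict_space_iff) auto
  qed
  then have "emeasure (pushforward eta N s) A
      = emeasure (restrict_space (completion eta) (dom s)) (s -` (Some ` A))"
    unfolding pushforward_def using A N by (simp only: emeasure_distr space v)
  also have "\<dots> = emeasure (completion eta) (s -` (Some ` A))"
    using dom_sets by (intro emeasure_restrict_space) auto
  also have "\<dots> = emeasure (piece a) A"
    using A by (rule emeasure_preimage)
  finally show "emeasure (pushforward eta N s) A = emeasure (piece a) A" .
qed

text \<open>Mass balance: the mass on \<open>A\<close> in limb \<open>a\<close> and the mass on the
  same fibres in limb \<open>b\<close> add up to a value fixed by the marginal and the core.\<close>

lemma emeasure_exchange:
  assumes A: "A \<in> sets \<gamma>"
  shows "emeasure \<mu> (p ` (A \<inter> K a))
    = emeasure \<gamma> (K a \<inter> A) + emeasure \<gamma> (K b \<inter> (p -` p ` (A \<inter> K a) \<inter> space \<gamma>))"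
proof -
  have "p ` (A \<inter> K a) \<subseteq> dom s"
    using section_K by auto
  then have "emeasure \<mu> (p ` (A \<inter> K a)) = emeasure \<gamma> (K a \<inter> p -` p ` (A \<inter> K a))
      + emeasure \<gamma> (K b \<inter> p -` p ` (A \<inter> K a))"
    using other image[OF A] by (intro emeasure_fibre) blast+
  moreover have "K b \<inter> p -` p ` (A \<inter> K a) = K b \<inter> (p -` p ` (A \<inter> K a) \<inter> space \<gamma>)"
    using sets.sets_into_space[OF K[of b]] by blast
  ultimately show ?thesis by (simp only: vimage_image)
qed

end

text \<open>Both measures satisfy the mass balance with the same total, so their discrepancies on
  \<open>a\<close> and \<open>b\<close> cancel. The set \<open>A'\<close> is built from
  \<open>A\<close>, \<open>p\<close>, \<open>K\<close> and the space alone and therefore serves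
  both.\<close>

lemma limb_pair_exchange:
  assumes "limb_pair \<mu> \<gamma> p K s a b" "limb_pair \<mu> \<gamma>' p K s a b"
    and "finite_measure \<gamma>" "finite_measure \<gamma>'" and sets: "sets \<gamma>' = sets \<gamma>" and A: "A \<in> sets \<gamma>"
  obtains A' where "A' \<in> sets \<gamma>"
    "\<bar>measure \<gamma> (K a \<inter> A) - measure \<gamma>' (K a \<inter> A)\<bar> = \<bar>measure \<gamma> (K b \<inter> A') - measure \<gamma>' (K b \<inter> A')\<bar>"
proof -
  interpret g: limb_pair \<mu> \<gamma> p K s a b by fact
  interpret g': limb_pair \<mu> \<gamma>' p K s a b by fact
  interpret fg: finite_measure \<gamma> by fact
  interpret fg': finite_measure \<gamma>' by fact
  define A' where "A' = p -` p ` (A \<inter> K a) \<inter> space \<gamma>"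
  have sp: "space \<gamma>' = space \<gamma>" using sets by (rule sets_eq_imp_space_eq)
  have "A' \<in> sets \<gamma>"
    unfolding A'_def using g.p g.image[OF A] by (rule measurable_sets)
  moreover have "emeasure \<gamma> (K a \<inter> A) + emeasure \<gamma> (K b \<inter> A')
      = emeasure \<gamma>' (K a \<inter> A) + emeasure \<gamma>' (K b \<inter> A')"
    using g.emeasure_exchange[OF A] g'.emeasure_exchange[of A] A sets sp by (simp add: A'_def)
  then have "measure \<gamma> (K a \<inter> A) + measure \<gamma> (K b \<inter> A')
      = measure \<gamma>' (K a \<inter> A) + measure \<gamma>' (K b \<inter> A')"
    by (simp add: fg.emeasure_eq_measure fg'.emeasure_eq_measure flip: ennreal_plus)
  ultimately show thesis by (intro that[of A']) auto
qed

section \<open>Limbs as subsets of the product\<close>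

text \<open>Graphs and antigraphs become sets in one product, so a single index runs through them.
  Index 0 gets the empty set because \<open>S\<close> starts at index 1 while \<open>g 0\<close> may
  have a nonempty domain.\<close>

definition limb :: "(nat \<Rightarrow> 'a \<rightharpoonup> 'b) \<Rightarrow> (nat \<Rightarrow> 'b \<rightharpoonup> 'a) \<Rightarrow> nat \<Rightarrow> ('a \<times> 'b) set" where
  "limb f g k = (if k = 0 then {} else if odd k then Map.graph (f k) else antigraph (g k))"

lemma limb_simps [simp]:
  "limb f g 0 = {}"
  "odd k \<Longrightarrow> limb f g k = Map.graph (f k)"
  "k > 0 \<Longrightarrow> even k \<Longrightarrow> limb f g k = antigraph (g k)"
  by (auto simp: limb_def)

lemma mem_graph_iff [simp]: "(x, y) \<in> Map.graph h \<longleftrightarrow> h x = Some y"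
  and mem_antigraph_iff [simp]: "(x, y) \<in> antigraph h' \<longleftrightarrow> h' y = Some x"
  by (auto simp: Map.graph_def antigraph_def)

lemma id_times_eq_Some [simp]: "id_times h x = Some z \<longleftrightarrow> fst z = x \<and> h x = Some (snd z)"
  and times_id_eq_Some [simp]: "times_id h' y = Some z \<longleftrightarrow> snd z = y \<and> h' y = Some (fst z)"
  by (cases z; auto simp: id_times_def times_id_def)+

lemma dom_id_times [simp]: "dom (id_times h) = dom h"
  and dom_times_id [simp]: "dom (times_id h') = dom h'"
  by (auto simp: id_times_def times_id_def dom_def)

lemma limb_eq_empty:
  assumes "at_most_limbs f g N" "k > N"
  shows "limb f g k = {}"
  using assms by (auto simp: at_most_limbs_def limb_def Map.graph_def antigraph_def)

text \<open>The pieces \<open>I\<close> and \<open>J\<close> are indexed by their original number halved.\<close>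

locale limb_system =
  \<mu>: sigma_finite_measure \<mu> + \<nu>: sigma_finite_measure \<nu>
  for \<mu> :: "'a::polish_space measure" and \<nu> :: "'b::polish_space measure" +
  fixes X :: "'a set" and Y :: "'b set"
    and f :: "nat \<Rightarrow> 'a \<rightharpoonup> 'b" and g :: "nat \<Rightarrow> 'b \<rightharpoonup> 'a"
    and I :: "nat \<Rightarrow> 'a set" and J :: "nat \<Rightarrow> 'b set"
  assumes sets_\<mu>: "sets \<mu> = sets (restrict_space borel X)"
    and sets_\<nu>: "sets \<nu> = sets (restrict_space borel Y)"
    and I_subset: "\<And>i. I i \<subseteq> X" and disjoint_I: "disjoint_family I"
    and J_subset: "\<And>i. J i \<subseteq> Y" and disjoint_J: "disjoint_family J"
    and dom_f: "\<And>i. dom (f (2*i+1)) \<subseteq> I i" and ran_f: "\<And>i. ran (f (2*i+1)) \<subseteq> J i"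
    and dom_g: "\<And>i. dom (g (2*i)) \<subseteq> J i" and ran_g: "\<And>i. ran (g (2*i+2)) \<subseteq> I i"
begin

lemma space_\<mu> [simp]: "space \<mu> = X" and space_\<nu> [simp]: "space \<nu> = Y"
  using sets_eq_imp_space_eq[OF sets_\<mu>] sets_eq_imp_space_eq[OF sets_\<nu>]
  by (simp_all add: space_restrict_space)

text \<open>The limbs climb a staircase of blocks: from an odd index to the next only the block in
  \<open>Y\<close> changes, from a positive even index to the next only the block in
  \<open>X\<close>.\<close>

lemma limb_block:
  assumes "z \<in> limb f g k"
  shows "k > 0" "fst z \<in> I ((k - 1) div 2)" "snd z \<in> J (k div 2)"
proof -
  show k: "k > 0" using assms by (cases k) auto
  obtain x y where z: "z = (x, y)" by force
  have "x \<in> I ((k - 1) div 2) \<and> y \<in> J (k div 2)"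
  proof (cases "odd k")
    case True
    then obtain i where i: "k = 2*i+1" by (rule oddE)
    then have "f (2*i+1) x = Some y" using assms z by simp
    then show ?thesis using dom_f[of i] ran_f[of i] i by (auto simp: ranI)
  next
    case False
    then obtain l where "k = 2*l" by auto
    \<comment> \<open>Writing the index as \<open>2*i+2\<close> fits \<open>ran_g\<close>; the
      domain then lies in block \<open>Suc i\<close> of \<open>Y\<close>.\<close>
    with k obtain i where i: "k = 2*i+2" by (cases l) auto
    then have "g (2*i+2) y = Some x" using assms z by simp
    then show ?thesis using dom_g[of "Suc i"] ran_g[of i] i by (auto simp: ranI)
  qed
  then show "fst z \<in> I ((k - 1) div 2)" "snd z \<in> J (k div 2)" using z by auto
qed

lemma limb_subset: "limb f g k \<subseteq> X \<times> Y"
proof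
  fix z assume z: "z \<in> limb f g k"
  show "z \<in> X \<times> Y"
    using subsetD[OF I_subset limb_block(2)[OF z]] subsetD[OF J_subset limb_block(3)[OF z]]
    by (simp add: mem_Times_iff)
qed

lemma I_inj: "x \<in> I i \<Longrightarrow> x \<in> I j \<Longrightarrow> i = j"
  using disjoint_I by (auto simp: disjoint_family_on_def)

lemma J_inj: "y \<in> J i \<Longrightarrow> y \<in> J j \<Longrightarrow> i = j"
  using disjoint_J by (auto simp: disjoint_family_on_def)

text \<open>The blocks of a point determine \<open>(k - 1) div 2\<close> and \<open>k div 2\<close>,
  and for positive \<open>k\<close> this pair determines \<open>k\<close>.\<close>

lemma limb_disjoint:
  assumes "z \<in> limb f g j" "z \<in> limb f g k"
  shows "j = k"
proof -
  have "(j - 1) div 2 = (k - 1) div 2"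
    by (rule I_inj[OF limb_block(2)[OF assms(1)] limb_block(2)[OF assms(2)]])
  moreover have "j div 2 = k div 2"
    by (rule J_inj[OF limb_block(3)[OF assms(1)] limb_block(3)[OF assms(2)]])
  moreover have "j > 0" "k > 0"
    by (rule limb_block(1)[OF assms(1)] limb_block(1)[OF assms(2)])+
  ultimately show ?thesis
    by (cases j; cases k; simp; cases "even j"; auto elim!: evenE oddE)
qed

lemma coupling_sets:
  assumes "\<gamma> \<in> couplings \<mu> \<nu>"
  shows "sets \<gamma> = sets (restrict_space borel (X \<times> Y))" "space \<gamma> = X \<times> Y"
proof -
  show "sets \<gamma> = sets (restrict_space borel (X \<times> Y))"
    using assms by (simp add: couplings_def borel_on_product_def)
  from sets_eq_imp_space_eq[OF this] show "space \<gamma> = X \<times> Y"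
    by (simp add: space_restrict_space)
qed

lemma measurable_projections:
  assumes "\<gamma> \<in> couplings \<mu> \<nu>"
  shows "fst \<in> \<gamma> \<rightarrow>\<^sub>M \<mu>" "snd \<in> \<gamma> \<rightarrow>\<^sub>M \<nu>"
  unfolding measurable_cong_sets[OF coupling_sets(1)[OF assms] sets_\<mu>]
    measurable_cong_sets[OF coupling_sets(1)[OF assms] sets_\<nu>]
  by (rule measurable_restrict_space3;
      auto intro!: borel_measurable_continuous_onI continuous_intros)+

section \<open>Compact cores of couplings\<close>

text \<open>The compact pieces are kept individually, by limb and position, so that continuous
  images can be taken piece by piece. Nullness is asked of the complement of the whole union, a
  condition stable under enlarging the pieces.\<close>

definition core :: "('a \<times> 'b) measure \<Rightarrow> (nat \<Rightarrow> nat \<Rightarrow> ('a \<times> 'b) set) \<Rightarrow> bool" where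
  "core \<gamma> C \<longleftrightarrow> (\<forall>k n. compact (C k n) \<and> C k n \<subseteq> limb f g k) \<and>
     space \<gamma> - (\<Union>k n. C k n) \<in> null_sets \<gamma>"

lemma core_exists:
  assumes \<gamma>: "\<gamma> \<in> couplings \<mu> \<nu>" and S: "vanishes_outside \<gamma> (\<Union>k. limb f g k)"
    and X: "vanishes_outside (distr \<mu> borel (\<lambda>x. x)) X"
    and Y: "vanishes_outside (distr \<nu> borel (\<lambda>y. y)) Y"
    and limbs: "\<And>k. limb f g k \<in> sets (completion \<gamma>)"
  obtains C where "core \<gamma> C"
proof -
  note sets_\<gamma> = coupling_sets(1)[OF \<gamma>] and space_\<gamma> = coupling_sets(2)[OF \<gamma>]
  note [measurable] = measurable_projections[OF \<gamma>]
  have marg: "distr \<gamma> \<mu> fst = \<mu>" "distr \<gamma> \<nu> snd = \<nu>"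
    using \<gamma> by (simp_all add: couplings_def)
  have sf: "sigma_finite_measure \<gamma>"
    using marg(1) \<mu>.sigma_finite_measure_axioms by (intro sigma_finite_measure_distr[of \<gamma> \<mu> fst]) auto
  obtain X0 where X0: "X0 \<in> sets borel" "X0 \<subseteq> X" "X - X0 \<in> null_sets \<mu>"
    using vanishes_outside_borel_core[OF sets_\<mu> X] by blast
  obtain Y0 where Y0: "Y0 \<in> sets borel" "Y0 \<subseteq> Y" "Y - Y0 \<in> null_sets \<nu>"
    using vanishes_outside_borel_core[OF sets_\<nu> Y] by blast
  \<comment> \<open>A point misses \<open>X0 \<times> Y0\<close> only if some coordinate lies in an
    exceptional null set, and the marginal conditions make both preimages null.\<close>
  have "X \<times> Y - X0 \<times> Y0 = (fst -` (X - X0) \<inter> space \<gamma>) \<union> (snd -` (Y - Y0) \<inter> space \<gamma>)"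
    using space_\<gamma> by auto
  moreover have "fst -` (X - X0) \<inter> space \<gamma> \<in> null_sets \<gamma>"
    using X0(3) null_sets_distr_iff[of fst \<gamma> \<mu>] marg(1) by simp
  moreover have "snd -` (Y - Y0) \<inter> space \<gamma> \<in> null_sets \<gamma>"
    using Y0(3) null_sets_distr_iff[of snd \<gamma> \<nu>] marg(2) by simp
  ultimately have Z0: "X \<times> Y - X0 \<times> Y0 \<in> null_sets \<gamma>" by auto
  have Z0': "X0 \<times> Y0 \<in> sets borel" "X0 \<times> Y0 \<subseteq> X \<times> Y"
    using X0 Y0 by (auto intro: borel_Times)
  have "\<exists>C :: nat \<Rightarrow> _. (\<forall>n. compact (C n) \<and> C n \<subseteq> limb f g k) \<and>
      limb f g k - (\<Union>n. C n) \<in> null_sets (completion \<gamma>)" for k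
    by (rule compact_core[OF sf sets_\<gamma> limbs Z0' Z0]) blast
  then obtain C :: "nat \<Rightarrow> nat \<Rightarrow> _" where C: "\<And>k n. compact (C k n)" "\<And>k n. C k n \<subseteq> limb f g k"
      "\<And>k. limb f g k - (\<Union>n. C k n) \<in> null_sets (completion \<gamma>)"
    by metis
  let ?U = "\<Union>k n. C k n"
  have "?U \<in> sets borel"
    using C(1) by (intro sets.countable_UN countable_UN_compact_borel) (auto intro: countable_UN_compact_borel)
  moreover have "?U \<subseteq> X \<times> Y" using C(2) limb_subset by blast
  ultimately have "?U \<in> sets \<gamma>"
    unfolding sets_\<gamma> sets_restrict_space by (auto intro!: image_eqI[of _ _ ?U])
  moreover have "(space \<gamma> - (\<Union>k. limb f g k)) \<union> (\<Union>k. limb f g k - (\<Union>n. C k n))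
      \<in> null_sets (completion \<gamma>)"
    using C(3) vanishes_outside_null_sets[OF S] by blast
  then have "space \<gamma> - ?U \<in> null_sets (completion \<gamma>)"
    by (rule null_sets_completion_subset[rotated]) blast
  ultimately have "space \<gamma> - ?U \<in> null_sets \<gamma>"
    using null_sets_completion_iff by blast
  then show thesis using C(1,2) by (intro that[of C]) (simp add: core_def)
qed

text \<open>Serves to put two couplings on a common core: adding compact subsets of the limbs can
  only shrink the exceptional set of \<open>\<gamma>\<close>.\<close>

lemma core_Un:
  assumes "core \<gamma> C" "core \<gamma>' D" and \<gamma>: "\<gamma> \<in> couplings \<mu> \<nu>"
  shows "core \<gamma> (\<lambda>k n. C k n \<union> D k n)"
proof -
  define U where "U = (\<Union>k n. C k n \<union> D k n)"
  have "U \<in> sets borel"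
    using assms(1,2) unfolding core_def U_def
    by (intro sets.countable_UN image_subsetI countable_UN_compact_borel compact_Un) auto
  then have "space \<gamma> - U \<in> sets \<gamma>"
    unfolding coupling_sets[OF \<gamma>] sets_restrict_space by (intro image_eqI[of _ _ "- U"]) auto
  moreover have "space \<gamma> - U \<subseteq> space \<gamma> - (\<Union>k n. C k n)"
    unfolding U_def by blast
  ultimately have "space \<gamma> - U \<in> null_sets \<gamma>"
    using assms(1) null_sets_subset unfolding core_def by metis
  then show ?thesis using assms(1,2) unfolding core_def U_def by auto
qed

section \<open>Recursion formulae for a coupling with a core\<close>

context
  fixes \<gamma> C K
  assumes \<gamma>: "\<gamma> \<in> couplings \<mu> \<nu>" and core: "core \<gamma> C"
  defines "K \<equiv> \<lambda>k. \<Union>n. C k n"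
begin

lemma K_limb: "K k \<subseteq> limb f g k"
  using core by (auto simp: core_def K_def)

lemma K_borel: "K k \<in> sets borel"
  using core unfolding core_def K_def by (intro countable_UN_compact_borel) blast

lemma K_sets: "K k \<in> sets \<gamma>"
  unfolding coupling_sets(1)[OF \<gamma>] sets_restrict_space
  using K_borel[of k] K_limb[of k] limb_subset[of k] by (intro image_eqI[of _ _ "K k"]) auto

lemma K_disjoint: "disjoint_family K"
  using K_limb limb_disjoint unfolding disjoint_family_on_def by blast

lemma K_carried: "space \<gamma> - (\<Union>k. K k) \<in> null_sets \<gamma>"
  using core by (simp add: core_def K_def)

lemma compact_C: "compact (C k n)"
  using core by (simp add: core_def)

lemma image_K_borel:
  fixes p :: "'a \<times> 'b \<Rightarrow> 'c::t2_space"
  assumes "continuous_on UNIV p"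
  shows "p ` K k \<in> sets borel"
proof -
  have "compact (p ` C k n)" for n
    using compact_C by (intro compact_continuous_image continuous_on_subset[OF assms]) auto
  then have "(\<Union>n. p ` C k n) \<in> sets borel"
    by (rule countable_UN_compact_borel)
  then show ?thesis by (simp add: K_def image_UN)
qed

lemma image_K_inj:
  fixes p :: "'a \<times> 'b \<Rightarrow> 'c::t2_space"
  assumes "continuous_on UNIV p" "inj_on p (K k)" "A \<in> sets \<gamma>"
  shows "p ` (A \<inter> K k) \<in> sets borel"
proof -
  obtain B where B: "B \<in> sets borel" "A = (X \<times> Y) \<inter> B"
    using assms(3) unfolding coupling_sets(1)[OF \<gamma>] sets_restrict_space by auto
  \<comment> \<open>\<open>A\<close> is Borel only relative to \<open>X \<times> Y\<close>, but the
    core lies in this product, so an ambient Borel set can replace it.\<close>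
  then have "A \<inter> K k = B \<inter> (\<Union>n. C k n)"
    using K_limb[of k] limb_subset[of k] by (auto simp: K_def)
  then show ?thesis
    using image_sigma_compact_borel[of p "C k", OF assms(1) compact_C _ B(1)] assms(2) by (simp add: K_def)
qed

lemma sets_\<mu>I: "A \<in> sets borel \<Longrightarrow> A \<subseteq> X \<Longrightarrow> A \<in> sets \<mu>"
  and sets_\<nu>I: "B \<in> sets borel \<Longrightarrow> B \<subseteq> Y \<Longrightarrow> B \<in> sets \<nu>"
  unfolding sets_\<mu> sets_\<nu> sets_restrict_space
  by (auto intro!: image_eqI[of _ _ A] image_eqI[of _ _ B])

lemma fst_K_subset: "fst ` K k \<subseteq> X" and snd_K_subset: "snd ` K k \<subseteq> Y"
  using K_limb[of k] limb_subset[of k] by auto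

text \<open>Only limbs \<open>2*i+1\<close> and \<open>2*i+2\<close> can project into block
  \<open>i\<close> of \<open>X\<close>, so over \<open>dom (f k)\<close> the sole partner of limb
  \<open>k\<close> is the next one.\<close>

lemma limb_pair_odd:
  assumes "odd k"
  shows "limb_pair \<mu> \<gamma> fst K (id_times (f k)) k (Suc k)"
proof -
  obtain i where i: "k = 2*i+1" using assms by (rule oddE)
  have K_graph: "f k x = Some y" if "(x, y) \<in> K k" for x y
    using that K_limb[of k] assms by auto
  have inj: "inj_on fst (K k)"
    by (auto simp: inj_on_def dest!: K_graph)
  show ?thesis
  proof
    show "fst \<in> \<gamma> \<rightarrow>\<^sub>M \<mu>" by (rule measurable_projections(1)[OF \<gamma>])
    show "distr \<gamma> \<mu> fst = \<mu>" using \<gamma> by (simp add: couplings_def)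
    show "fst ` K j \<in> sets \<mu>" for j
      by (intro sets_\<mu>I image_K_borel fst_K_subset continuous_intros)
    show "K k \<inter> K (Suc k) = {}"
      using K_disjoint by (auto simp: disjoint_family_on_def)
    show "id_times (f k) (fst z) = Some z" if "z \<in> K k" for z
      using that K_graph by (cases z) auto
    show "z \<in> space \<gamma> \<and> fst z = x" if "id_times (f k) x = Some z" for x z
    proof -
      have "z \<in> limb f g k" using that assms by (cases z) auto
      then show ?thesis using limb_subset coupling_sets(2)[OF \<gamma>] that by auto
    qed
    show "fst ` (A \<inter> K k) \<in> sets \<mu>" if "A \<in> sets \<gamma>" for A
      using fst_K_subset[of k] that inj
      by (intro sets_\<mu>I image_K_inj continuous_intros) auto
    show "dom (id_times (f k)) \<inter> fst ` K j = {}" if "j \<noteq> k" "j \<noteq> Suc k" for j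
    proof -
      have "x \<notin> dom (f k)" if x: "x \<in> fst ` K j" for x
      proof
        assume "x \<in> dom (f k)"
        then have "x \<in> I i" using dom_f[of i] i by auto
        moreover obtain z where "z \<in> limb f g j" "fst z = x" using x K_limb[of j] by blast
        \<comment> \<open>\<open>j > 0\<close> rules out index 0, for which truncated subtraction
          would also give block 0.\<close>
        ultimately have "(j - 1) div 2 = i" "j > 0"
          using I_inj[of x] limb_block(1,2)[of z j] by auto
        then show False using \<open>j \<noteq> k\<close> \<open>j \<noteq> Suc k\<close> i by presburger
      qed
      then show ?thesis by auto
    qed
  qed (rule K_sets K_carried)+
qed

text \<open>The blocks of \<open>Y\<close> pair limb \<open>2*i\<close> with limb
  \<open>2*i+1\<close>, so the partner is again the next limb.\<close>

lemma limb_pair_even: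
  assumes "even k" "k > 0"
  shows "limb_pair \<nu> \<gamma> snd K (times_id (g k)) k (Suc k)"
proof -
  obtain i where i: "k = 2*i" using assms(1) by (rule evenE)
  have K_graph: "g k y = Some x" if "(x, y) \<in> K k" for x y
    using that K_limb[of k] assms by auto
  have inj: "inj_on snd (K k)"
    by (auto simp: inj_on_def dest!: K_graph)
  show ?thesis
  proof
    show "snd \<in> \<gamma> \<rightarrow>\<^sub>M \<nu>" by (rule measurable_projections(2)[OF \<gamma>])
    show "distr \<gamma> \<nu> snd = \<nu>" using \<gamma> by (simp add: couplings_def)
    show "snd ` K j \<in> sets \<nu>" for j
      by (intro sets_\<nu>I image_K_borel snd_K_subset continuous_intros)
    show "K k \<inter> K (Suc k) = {}"
      using K_disjoint by (auto simp: disjoint_family_on_def)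
    show "times_id (g k) (snd z) = Some z" if "z \<in> K k" for z
      using that K_graph by (cases z) auto
    show "z \<in> space \<gamma> \<and> snd z = y" if "times_id (g k) y = Some z" for y z
    proof -
      have "z \<in> limb f g k" using that assms by (cases z) auto
      then show ?thesis using limb_subset coupling_sets(2)[OF \<gamma>] that by auto
    qed
    show "snd ` (A \<inter> K k) \<in> sets \<nu>" if "A \<in> sets \<gamma>" for A
      using snd_K_subset[of k] that inj
      by (intro sets_\<nu>I image_K_inj continuous_intros) auto
    show "dom (times_id (g k)) \<inter> snd ` K j = {}" if "j \<noteq> k" "j \<noteq> Suc k" for j
    proof -
      have "y \<notin> dom (g k)" if y: "y \<in> snd ` K j" for y
      proof
        assume "y \<in> dom (g k)"
        then have "y \<in> J i" using dom_g[of i] i by auto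
        moreover obtain z where "z \<in> limb f g j" "snd z = y" using y K_limb[of j] by blast
        ultimately have "j div 2 = i" using J_inj[of y] limb_block(3)[of z j] by auto
        then show False using \<open>j \<noteq> k\<close> \<open>j \<noteq> Suc k\<close> i by presburger
      qed
      then show ?thesis by auto
    qed
  qed (rule K_sets K_carried)+
qed

lemma emeasure_sum_K:
  assumes A: "A \<in> sets \<gamma>"
  shows "emeasure \<gamma> A = (\<Sum>k. emeasure \<gamma> (K (Suc k) \<inter> A))"
proof -
  \<comment> \<open>This is why the sum may start at \<open>Suc k\<close>.\<close>
  have "K 0 = {}" using K_limb[of 0] by simp
  have "emeasure \<gamma> A = emeasure \<gamma> (\<Union>k. K (Suc k) \<inter> A)"
  proof (rule emeasure_eq_AE)
    show "AE z in \<gamma>. z \<in> A \<longleftrightarrow> z \<in> (\<Union>k. K (Suc k) \<inter> A)"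
      using AE_not_in[OF K_carried] AE_space
    proof eventually_elim
      case (elim z)
      then obtain k where "z \<in> K k" by auto
      then show ?case using \<open>K 0 = {}\<close> by (cases k) auto
    qed
    show "(\<Union>k. K (Suc k) \<inter> A) \<in> sets \<gamma>" using A K_sets by auto
  qed (use A in auto)
  also have "\<dots> = (\<Sum>k. emeasure \<gamma> (K (Suc k) \<inter> A))"
  proof (rule suminf_emeasure[symmetric])
    show "range (\<lambda>k. K (Suc k) \<inter> A) \<subseteq> sets \<gamma>" using A K_sets by auto
    have "K (Suc m) \<inter> K (Suc n) = {}" if "m \<noteq> n" for m n
      using K_disjoint that by (simp add: disjoint_family_on_def)
    then show "disjoint_family (\<lambda>k. K (Suc k) \<inter> A)"
      unfolding disjoint_family_on_def by blast
  qed
  finally show ?thesis .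
qed

lemma emeasure_part:
  "A \<in> sets \<gamma> \<Longrightarrow> emeasure (density \<gamma> (indicator (K k))) A = emeasure \<gamma> (K k \<inter> A)"
  using K_sets by (rule emeasure_restricted)

lemma sets_product: "sets (borel_on_product \<mu> \<nu>) = sets \<gamma>"
  using \<gamma> by (simp add: couplings_def)

text \<open>Taking \<open>\<eta>\<close> to be the projection of the part itself means that the
  recursive formulae are verified for known measures rather than solved.\<close>

lemma part_formulae_odd:
  assumes "odd k"
  defines "\<eta> \<equiv> distr (density \<gamma> (indicator (K k))) \<mu> fst"
  shows "\<eta> = restrict_measure
      (measure_minus \<mu> (distr (density \<gamma> (indicator (K (Suc k)))) \<mu> fst)) (dom (f k))"
    and "density \<gamma> (indicator (K k)) = pushforward \<eta> (borel_on_product \<mu> \<nu>) (id_times (f k))"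
    and "completion_measurable \<eta> \<nu> (f k)"
proof -
  interpret limb_pair \<mu> \<gamma> fst K "id_times (f k)" k "Suc k"
    using assms(1) by (rule limb_pair_odd)
  show "\<eta> = restrict_measure
      (measure_minus \<mu> (distr (density \<gamma> (indicator (K (Suc k)))) \<mu> fst)) (dom (f k))"
    using restrict_minus_marginal by (simp add: \<eta>_def)
  show "density \<gamma> (indicator (K k)) = pushforward \<eta> (borel_on_product \<mu> \<nu>) (id_times (f k))"
    using pushforward_eta[OF sets_product] by (simp add: \<eta>_def)
  show "completion_measurable \<eta> \<nu> (f k)"
    unfolding completion_measurable_def
  proof
    fix B assume "B \<in> sets \<nu>"
    \<comment> \<open>Preimages under \<open>f k\<close> are preimages of cylinders under the
      section \<open>id_times (f k)\<close>, whose measurability is known.\<close>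
    then have "snd -` B \<inter> space \<gamma> \<in> sets \<gamma>"
      using measurable_projections(2)[OF \<gamma>] by (rule measurable_sets[rotated])
    moreover have "(x, y) \<in> space \<gamma>" if "f k x = Some y" for x y
      using s_section[of x "(x, y)"] that by simp
    then have "id_times (f k) -` (Some ` (snd -` B \<inter> space \<gamma>)) = f k -` (Some ` B)"
      by (auto simp: id_times_def)
    ultimately show "f k -` (Some ` B) \<in> sets (completion \<eta>)"
      using preimage_sets unfolding \<eta>_def by metis
  qed
qed

lemma part_formulae_even:
  assumes "even k" "k > 0"
  defines "\<eta> \<equiv> distr (density \<gamma> (indicator (K k))) \<nu> snd"
  shows "\<eta> = restrict_measure
      (measure_minus \<nu> (distr (density \<gamma> (indicator (K (Suc k)))) \<nu> snd)) (dom (g k))"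
    and "density \<gamma> (indicator (K k)) = pushforward \<eta> (borel_on_product \<mu> \<nu>) (times_id (g k))"
    and "completion_measurable \<eta> \<mu> (g k)"
proof -
  interpret limb_pair \<nu> \<gamma> snd K "times_id (g k)" k "Suc k"
    using assms(1,2) by (rule limb_pair_even)
  show "\<eta> = restrict_measure
      (measure_minus \<nu> (distr (density \<gamma> (indicator (K (Suc k)))) \<nu> snd)) (dom (g k))"
    using restrict_minus_marginal by (simp add: \<eta>_def)
  show "density \<gamma> (indicator (K k)) = pushforward \<eta> (borel_on_product \<mu> \<nu>) (times_id (g k))"
    using pushforward_eta[OF sets_product] by (simp add: \<eta>_def)
  show "completion_measurable \<eta> \<mu> (g k)"
    unfolding completion_measurable_def
  proof
    fix B assume "B \<in> sets \<mu>"
    then have "fst -` B \<inter> space \<gamma> \<in> sets \<gamma>"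
      using measurable_projections(1)[OF \<gamma>] by (rule measurable_sets[rotated])
    moreover have "(x, y) \<in> space \<gamma>" if "g k y = Some x" for x y
      using s_section[of y "(x, y)"] that by simp
    then have "times_id (g k) -` (Some ` (fst -` B \<inter> space \<gamma>)) = g k -` (Some ` B)"
      by (auto simp: times_id_def)
    ultimately show "g k -` (Some ` B) \<in> sets (completion \<eta>)"
      using preimage_sets unfolding \<eta>_def by metis
  qed
qed

lemma part_null:
  assumes "at_most_limbs f g N" "k > N"
  shows "density \<gamma> (indicator (K k)) = null_measure (borel_on_product \<mu> \<nu>)"
proof (rule null_measure_eqI)
  have "K k = {}" using K_limb[of k] limb_eq_empty[OF assms] by simp
  then show "emeasure (density \<gamma> (indicator (K k))) (space (density \<gamma> (indicator (K k)))) = 0"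
    using emeasure_part[OF sets.top, of k] by simp
qed (simp add: sets_product)

text \<open>The recursion descends, so the induction is on the distance to \<open>N + 1\<close>:
  above \<open>N\<close> both sides are null, and otherwise part \<open>k\<close> arises from part
  \<open>k + 1\<close> by the same formula.\<close>

lemma part_eq_limb_gamma:
  assumes N: "at_most_limbs f g N" and "k > 0"
  shows "density \<gamma> (indicator (K k)) = limb_gamma \<mu> \<nu> f g N k"
  using \<open>k > 0\<close>
proof (induction "Suc N - k" arbitrary: k)
  case 0
  then show ?case
    using part_null[OF N, of k] by (simp add: limb_gamma.simps)
next
  case (Suc n)
  then have "density \<gamma> (indicator (K (Suc k))) = limb_gamma \<mu> \<nu> f g N (Suc k)" by simp
  moreover have "\<not> N < k" using Suc.hyps(2) by simp
  ultimately show ?case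
    using part_formulae_odd[of k] part_formulae_even[of k] \<open>k > 0\<close>
    by (subst limb_gamma.simps) (simp add: limb_eta_odd_def limb_eta_even_def)
qed

end

section \<open>Uniqueness of couplings\<close>

text \<open>The measures \<open>limb_gamma\<close> are built from the marginals and the maps alone,
  so the parts of a coupling depend neither on it nor on its core; the two cores may differ.\<close>

lemma coupling_unique_of_finite_limbs:
  assumes \<gamma>: "\<gamma> \<in> couplings \<mu> \<nu>" "core \<gamma> C" and \<gamma>': "\<gamma>' \<in> couplings \<mu> \<nu>" "core \<gamma>' C'"
    and N: "at_most_limbs f g N"
  shows "\<gamma> = \<gamma>'"
proof (rule measure_eqI)
  show sets: "sets \<gamma> = sets \<gamma>'"
    using coupling_sets(1)[OF \<gamma>(1)] coupling_sets(1)[OF \<gamma>'(1)] by simp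
  fix A assume A: "A \<in> sets \<gamma>"
  have "emeasure \<rho> A = (\<Sum>k. emeasure (limb_gamma \<mu> \<nu> f g N (Suc k)) A)"
    if \<rho>: "\<rho> \<in> couplings \<mu> \<nu>" "core \<rho> D" and A: "A \<in> sets \<rho>" for \<rho> D
  proof -
    have "emeasure \<rho> ((\<Union>n. D (Suc k) n) \<inter> A) = emeasure (limb_gamma \<mu> \<nu> f g N (Suc k)) A" for k
      using emeasure_part[OF \<rho> A, of "Suc k"] part_eq_limb_gamma[OF \<rho> N, of "Suc k"] by simp
    then show ?thesis
      using emeasure_sum_K[OF \<rho> A] by simp
  qed
  from this[OF \<gamma> A] this[OF \<gamma>'] A sets show "emeasure \<gamma> A = emeasure \<gamma>' A" by simp
qed

text \<open>There need not be a last limb, so a discrepancy is pushed to ever later limbs. The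
  common core makes the discrepancies of both couplings refer to the same sets.\<close>

lemma coupling_unique_of_finite_measure:
  assumes \<gamma>: "\<gamma> \<in> couplings \<mu> \<nu>" "core \<gamma> C" and \<gamma>': "\<gamma>' \<in> couplings \<mu> \<nu>" "core \<gamma>' C"
    and fin: "emeasure \<mu> X < \<infinity>"
  shows "\<gamma> = \<gamma>'"
proof -
  define K where "K k = (\<Union>n. C k n)" for k
  have sets: "sets \<gamma>' = sets \<gamma>"
    using coupling_sets(1)[OF \<gamma>(1)] coupling_sets(1)[OF \<gamma>'(1)] by simp
  have finite: "finite_measure \<rho>" if "\<rho> \<in> couplings \<mu> \<nu>" for \<rho>
  proof (rule finite_measureI)
    have "emeasure \<rho> (fst -` X \<inter> space \<rho>) = emeasure (distr \<rho> \<mu> fst) X"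
      using measurable_projections(1)[OF that] by (intro emeasure_distr[symmetric]) (auto simp flip: space_\<mu>)
    moreover have "fst -` X \<inter> space \<rho> = space \<rho>"
      using coupling_sets(2)[OF that] by auto
    ultimately show "emeasure \<rho> (space \<rho>) \<noteq> \<infinity>"
      using that fin by (simp add: couplings_def)
  qed
  interpret g: finite_measure \<gamma> by (rule finite[OF \<gamma>(1)])
  interpret g': finite_measure \<gamma>' by (rule finite[OF \<gamma>'(1)])
  define \<Delta> where "\<Delta> k A = \<bar>measure \<gamma> (K k \<inter> A) - measure \<gamma>' (K k \<inter> A)\<bar>" for k A
  have K_sets: "K k \<in> sets \<gamma>" "K k \<in> sets \<gamma>'" for k
    using K_sets[OF \<gamma>, of k] K_sets[OF \<gamma>', of k] by (simp_all add: K_def)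
  have step: "\<exists>A'\<in>sets \<gamma>. \<Delta> k A = \<Delta> (Suc k) A'" if "k > 0" "A \<in> sets \<gamma>" for k A
  proof (cases "odd k")
    case True
    show ?thesis
      using limb_pair_exchange[OF limb_pair_odd[OF \<gamma> True] limb_pair_odd[OF \<gamma>' True]
          g.finite_measure_axioms g'.finite_measure_axioms sets that(2)]
      unfolding \<Delta>_def K_def by metis
  next
    case False
    then have "even k" by simp
    then show ?thesis
      using limb_pair_exchange[OF limb_pair_even[OF \<gamma> _ that(1)] limb_pair_even[OF \<gamma>' _ that(1)]
          g.finite_measure_axioms g'.finite_measure_axioms sets that(2)]
      unfolding \<Delta>_def K_def by metis
  qed
  \<comment> \<open>Each exchange changes the test set but keeps the discrepancy, while the index
    grows.\<close>
  have shift: "\<exists>A'\<in>sets \<gamma>. \<Delta> k A = \<Delta> (n + k) A'" if "k > 0" "A \<in> sets \<gamma>" for k A n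
  proof (induction n)
    case 0
    then show ?case using that by auto
  next
    case (Suc n)
    then show ?case using step[of "n + k"] that by (metis add_Suc add_gr_0)
  qed
  \<comment> \<open>Disjoint sets have summable masses under a finite measure.\<close>
  have tendsto: "(\<lambda>k. measure \<rho> (K k)) \<longlonglongrightarrow> 0" if "finite_measure \<rho>" "\<And>k. K k \<in> sets \<rho>" for \<rho>
  proof -
    have "(\<lambda>k. measure \<rho> (K k)) sums measure \<rho> (\<Union>k. K k)"
      using that K_disjoint[OF \<gamma>, folded K_def] by (intro finite_measure.finite_measure_UNION) auto
    then show ?thesis by (intro summable_LIMSEQ_zero) (rule sums_summable)
  qed
  have zero: "\<Delta> k A = 0" if kA: "k > 0" "A \<in> sets \<gamma>" for k A
  proof -
    let ?m = "\<lambda>n. measure \<gamma> (K (n + k)) + measure \<gamma>' (K (n + k))"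
    have "(\<lambda>k. measure \<gamma> (K k) + measure \<gamma>' (K k)) \<longlonglongrightarrow> 0 + 0"
      using tendsto[OF g.finite_measure_axioms] tendsto[OF g'.finite_measure_axioms] K_sets
      by (intro tendsto_add) auto
    then have lim: "?m \<longlonglongrightarrow> 0"
      using LIMSEQ_ignore_initial_segment by fastforce
    \<comment> \<open>Nothing is known about the test set \<open>A'\<close>, so it is bounded by the
      whole limb core.\<close>
    have "\<Delta> k A \<le> ?m n" for n
    proof -
      obtain A' where A': "A' \<in> sets \<gamma>" "\<Delta> k A = \<Delta> (n + k) A'" 
        using shift[OF kA, of n] by (rule bexE)
      have "measure \<gamma> (K (n + k) \<inter> A') \<le> measure \<gamma> (K (n + k))"
        "measure \<gamma>' (K (n + k) \<inter> A') \<le> measure \<gamma>' (K (n + k))"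
        using K_sets by (auto intro!: g.finite_measure_mono g'.finite_measure_mono)
      moreover have "0 \<le> measure \<gamma> (K (n + k) \<inter> A')" "0 \<le> measure \<gamma>' (K (n + k) \<inter> A')" by simp_all
      ultimately have "\<Delta> (n + k) A' \<le> ?m n" unfolding \<Delta>_def by linarith
      then show ?thesis using A'(2) by simp
    qed
    then have "\<Delta> k A \<le> 0"
      using LIMSEQ_le_const[OF lim] by blast
    then show ?thesis by (simp add: \<Delta>_def)
  qed
  show ?thesis
  proof (rule measure_eqI)
    fix A assume A: "A \<in> sets \<gamma>"
    have "emeasure \<gamma> (K (Suc k) \<inter> A) = emeasure \<gamma>' (K (Suc k) \<inter> A)" for k
      using zero[OF _ A, of "Suc k"] by (simp add: \<Delta>_def g.emeasure_eq_measure g'.emeasure_eq_measure)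
    then show "emeasure \<gamma> A = emeasure \<gamma>' A"
      using emeasure_sum_K[OF \<gamma> A] emeasure_sum_K[OF \<gamma>', of A] A sets by (simp add: K_def)
  qed (simp add: sets)
qed

end

section \<open>Assembly for a numbered limb system\<close>

theorem theorem3p2:
  fixes X :: "'a::polish_space set" and Y :: "'b::polish_space set"
    and \<mu> :: "'a measure" and \<nu> :: "'b measure"
    and S :: "('a \<times> 'b) set"
    and f :: "nat \<Rightarrow> 'a \<rightharpoonup> 'b" and g :: "nat \<Rightarrow> 'b \<rightharpoonup> 'a"
  assumes "sets \<mu> = sets (restrict_space borel X)" and "sigma_finite_measure \<mu>"
    and "sets \<nu> = sets (restrict_space borel Y)" and "sigma_finite_measure \<nu>"
    and "vanishes_outside (distr \<mu> borel (\<lambda>x. x)) X"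
    and "vanishes_outside (distr \<nu> borel (\<lambda>y. y)) Y"
    and "numbered_limb_system X Y S f g"
    and "\<And>\<gamma> i. \<lbrakk>\<gamma> \<in> couplings \<mu> \<nu>; vanishes_outside \<gamma> S; i \<ge> 1\<rbrakk> \<Longrightarrow>
           Map.graph (f (2*i-1)) \<in> sets (completion \<gamma>) \<and>
           antigraph (g (2*i)) \<in> sets (completion \<gamma>)"
  shows "((\<exists>N. at_most_limbs f g N) \<or> emeasure \<mu> X < \<infinity> \<longrightarrow>
            (\<exists>\<^sub>\<le>\<^sub>1 \<gamma>. \<gamma> \<in> couplings \<mu> \<nu> \<and> vanishes_outside \<gamma> S)) \<and>
         (\<forall>\<gamma>. \<gamma> \<in> couplings \<mu> \<nu> \<and> vanishes_outside \<gamma> S \<longrightarrow>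
            (\<exists>(\<gamma>s :: nat \<Rightarrow> ('a \<times> 'b) measure) (\<eta>odd :: nat \<Rightarrow> 'a measure) (\<eta>even :: nat \<Rightarrow> 'b measure).
               (\<forall>A \<in> sets \<gamma>. emeasure \<gamma> A = (\<Sum>k. emeasure (\<gamma>s (Suc k)) A)) \<and>
               (\<forall>i\<ge>1.
                  \<gamma>s (2*i-1) = pushforward (\<eta>odd (2*i-1)) (borel_on_product \<mu> \<nu>) (id_times (f (2*i-1))) \<and>
                  \<gamma>s (2*i) = pushforward (\<eta>even (2*i)) (borel_on_product \<mu> \<nu>) (times_id (g (2*i))) \<and>
                  \<eta>odd (2*i-1) =
                    restrict_measure (measure_minus \<mu> (distr (\<gamma>s (2*i)) \<mu> fst)) (dom (f (2*i-1))) \<and>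
                  \<eta>even (2*i) =
                    restrict_measure (measure_minus \<nu> (distr (\<gamma>s (2*i+1)) \<nu> snd)) (dom (g (2*i))) \<and>
                  completion_measurable (\<eta>odd (2*i-1)) \<nu> (f (2*i-1)) \<and>
                  completion_measurable (\<eta>even (2*i)) \<mu> (g (2*i))) \<and>
               (\<forall>N. at_most_limbs f g N \<longrightarrow>
                  (\<forall>k>N. k \<ge> 1 \<longrightarrow> \<gamma>s k = null_measure (borel_on_product \<mu> \<nu>)) \<and>
                  (\<forall>k. 1 \<le> k \<and> k \<le> N \<longrightarrow>
                     \<gamma>s k = limb_gamma \<mu> \<nu> f g N k \<and>
                     (odd k \<longrightarrow> \<eta>odd k = limb_eta_odd \<mu> f k (limb_gamma \<mu> \<nu> f g N (Suc k))) \<and>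
                     (even k \<longrightarrow> \<eta>even k = limb_eta_even \<nu> g k (limb_gamma \<mu> \<nu> f g N (Suc k)))))))"
proof -
  from assms(7) obtain I J where
    I: "X = (\<Union>i. I (2*i+1))" "disjoint_family (\<lambda>i. I (2*i+1))"
    and J: "Y = (\<Union>i. J (2*i))" "disjoint_family (\<lambda>i. J (2*i))"
    and dJ: "\<And>i. dom (g (2*i)) \<union> ran (f (2*i+1)) \<subseteq> J (2*i)"
    and dI: "\<And>i. dom (f (2*i+1)) \<union> ran (g (2*i+2)) \<subseteq> I (2*i+1)"
    and S: "S = (\<Union>i\<in>{1..}. Map.graph (f (2*i-1)) \<union> antigraph (g (2*i)))"
    unfolding numbered_limb_system_def by blast
  interpret limb_system \<mu> \<nu> X Y f g "\<lambda>i. I (2*i+1)" "\<lambda>i. J (2*i)"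
    using assms(1-4) I J dI dJ by (auto simp: limb_system_def limb_system_axioms_def)
  have limb_pairs: "Map.graph (f (2*i-1)) = limb f g (2*i-1)" "antigraph (g (2*i)) = limb f g (2*i)"
    if "i \<ge> 1" for i
    using that by (auto simp: limb_def)
  \<comment> \<open>Passes between the pairs \<open>2*i-1\<close>, \<open>2*i\<close> that make up
    \<open>S\<close> and the single index of \<open>limb\<close>.\<close>
  have index: "k = 0 \<or> (\<exists>i\<ge>1. k = 2*i-1 \<or> k = 2*i)" for k :: nat
    by presburger
  have S_limb: "S = (\<Union>k. limb f g k)"
  proof
    show "S \<subseteq> (\<Union>k. limb f g k)"
      unfolding S using limb_pairs by (intro UN_least Un_least) (metis UN_upper UNIV_I atLeast_iff)+
    show "(\<Union>k. limb f g k) \<subseteq> S"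
    proof (rule UN_least)
      fix k :: nat
      consider "k = 0" | i where "i \<ge> 1" "k = 2*i-1" | i where "i \<ge> 1" "k = 2*i"
        using index[of k] by blast
      then show "limb f g k \<subseteq> S"
        unfolding S using limb_pairs by cases (simp, blast+)
    qed
  qed
  have core: "\<exists>C. core \<gamma> C" if "\<gamma> \<in> couplings \<mu> \<nu>" "vanishes_outside \<gamma> S" for \<gamma>
  proof -
    have "limb f g k \<in> sets (completion \<gamma>)" for k
    proof -
      consider "k = 0" | i where "i \<ge> 1" "k = 2*i-1" | i where "i \<ge> 1" "k = 2*i"
        using index[of k] by blast
      then show ?thesis
      proof cases
        case (2 i)
        then show ?thesis using assms(8)[OF that 2(1)] limb_pairs(1)[OF 2(1)] by (simp only:)
      next
        case (3 i)
        then show ?thesis using assms(8)[OF that 3(1)] limb_pairs(2)[OF 3(1)] by (simp only:)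
      qed simp
    qed
    then show ?thesis
      using core_exists[OF that(1) that(2)[unfolded S_limb] assms(5,6)] by blast
  qed
  have unique: "\<gamma> = \<gamma>'"
    if fin: "(\<exists>N. at_most_limbs f g N) \<or> emeasure \<mu> X < \<infinity>"
      and \<gamma>: "\<gamma> \<in> couplings \<mu> \<nu>" "vanishes_outside \<gamma> S"
      and \<gamma>': "\<gamma>' \<in> couplings \<mu> \<nu>" "vanishes_outside \<gamma>' S" for \<gamma> \<gamma>'
  proof -
    obtain C C' where C: "core \<gamma> C" and C': "core \<gamma>' C'"
      using core[OF \<gamma>] core[OF \<gamma>'] by blast
    \<comment> \<open>Each core is enlarged by the other; the unions, in opposite orders, coincide
      by commutativity and form a common core.\<close>
    have "core \<gamma> (\<lambda>k n. C k n \<union> C' k n)" "core \<gamma>' (\<lambda>k n. C' k n \<union> C k n)"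
      by (rule core_Un[OF C C' \<gamma>(1)] core_Un[OF C' C \<gamma>'(1)])+
    then show ?thesis
      using fin coupling_unique_of_finite_limbs[OF \<gamma>(1) C \<gamma>'(1) C']
        coupling_unique_of_finite_measure[OF \<gamma>(1) _ \<gamma>'(1)]
      by (auto simp: Un_commute)
  qed
  show ?thesis
  proof (intro conjI impI allI, goal_cases)
    case 1
    then show ?case using unique unfolding Uniq_def by blast
  next
    case (2 \<gamma>)
    then obtain C where \<gamma>: "\<gamma> \<in> couplings \<mu> \<nu>" "core \<gamma> C" using core by blast
    \<comment> \<open>The parts are restrictions of \<open>\<gamma>\<close> to the disjoint limb
      cores, which together carry all of its mass; hence they add up to
      \<open>\<gamma>\<close>.\<close>
    define \<gamma>s where "\<gamma>s k = density \<gamma> (indicator (\<Union>n. C k n))" for k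
    define \<eta>odd where "\<eta>odd k = distr (\<gamma>s k) \<mu> fst" for k
    define \<eta>even where "\<eta>even k = distr (\<gamma>s k) \<nu> snd" for k
    note odd = part_formulae_odd[OF \<gamma>, folded \<gamma>s_def]
    note even = part_formulae_even[OF \<gamma>, folded \<gamma>s_def]
    note null = part_null[OF \<gamma>, folded \<gamma>s_def]
    note rec = part_eq_limb_gamma[OF \<gamma>, folded \<gamma>s_def]
    have total: "\<forall>A\<in>sets \<gamma>. emeasure \<gamma> A = (\<Sum>k. emeasure (\<gamma>s (Suc k)) A)"
      using emeasure_sum_K[OF \<gamma>] emeasure_part[OF \<gamma>, folded \<gamma>s_def] by simp
    \<comment> \<open>For \<open>i \<ge> 1\<close> the truncated \<open>2*i-1\<close> is the true
      predecessor of \<open>2*i\<close>.\<close>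
    have index: "odd (2*i-1)" "Suc (2*i-1) = 2*i" "even (2*i)" "2*i > 0" if "i \<ge> 1" for i :: nat
      using that by auto
    \<comment> \<open>Part \<open>k + 1\<close> is replaced by its recursive value, which for
      \<open>k = N\<close> is the null measure starting the recursion.\<close>
    have eta: "odd k \<Longrightarrow> \<eta>odd k = limb_eta_odd \<mu> f k (limb_gamma \<mu> \<nu> f g N (Suc k))"
      "even k \<Longrightarrow> k \<ge> 1 \<Longrightarrow> \<eta>even k = limb_eta_even \<nu> g k (limb_gamma \<mu> \<nu> f g N (Suc k))"
      if "at_most_limbs f g N" for k N
      using odd(1)[of k] even(1)[of k] rec[OF that, of "Suc k"]
      by (simp_all add: limb_eta_odd_def limb_eta_even_def \<eta>odd_def \<eta>even_def)
    show ?case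
    proof (rule exI[of _ \<gamma>s], rule exI[of _ \<eta>odd], rule exI[of _ \<eta>even], intro conjI allI impI)
      fix i :: nat assume i: "i \<ge> 1"
      note i = index[OF i]
      show "\<gamma>s (2*i-1) = pushforward (\<eta>odd (2*i-1)) (borel_on_product \<mu> \<nu>) (id_times (f (2*i-1)))"
        "completion_measurable (\<eta>odd (2*i-1)) \<nu> (f (2*i-1))"
        "\<eta>odd (2*i-1) = restrict_measure (measure_minus \<mu> (distr (\<gamma>s (2*i)) \<mu> fst)) (dom (f (2*i-1)))"
        using odd[OF i(1)] i(2) by (simp_all add: \<eta>odd_def)
      show "\<gamma>s (2*i) = pushforward (\<eta>even (2*i)) (borel_on_product \<mu> \<nu>) (times_id (g (2*i)))"
        "completion_measurable (\<eta>even (2*i)) \<mu> (g (2*i))"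
        "\<eta>even (2*i) = restrict_measure (measure_minus \<nu> (distr (\<gamma>s (2*i+1)) \<nu> snd)) (dom (g (2*i)))"
        using even[OF i(3,4)] by (simp_all add: \<eta>even_def)
    qed (use total eta null rec in auto)
  qed
qed

end
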